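(* There exist absolute constants $c,C,A,B>0$ such that the following holds for all integers $n\ge 2$ and $d\ge1$ with $d\ge\tilde O(\sqrt n)$, that is, $d\ge B\sqrt{n}\,(\log n)^{A}$. Let $M$ be a $\left(1,\frac1{d^2}\right)$-differentially private algorithm that, for any $X_1,\dots,X_n$ in the unit ball of $\mathbb{R}^d$, outputs with probability at least $3/4$ a matrix within Frobenius distance $\alpha$ of the empirical covariance of $X_1,\dots,X_n$. Then $$\alpha\ \ge\ \frac{c}{(\log n)^{C}}\cdot\frac{d}{n}\quad\text{if } d\le n^{2/3},\qquad\qquad \alpha\ \ge\ \frac{c}{(\log n)^{C}}\cdot\frac{1}{n^{1/3}}\quad\text{if } d\ge n^{2/3}.$$
   Context: A randomized algorithm $M:\mathcal{X}^n\to\mathcal{O}$ is $(\varepsilon,\delta)$-differentially private if for any two datasets $\mathbf{X},\mathbf{X}'\in\mathcal{X}^n$ that differ in only a single data point and any (measurable) $O\subset\mathcal{O}$, $\mathbb{P}[M(\mathbf{X}')\in O]\le e^{\varepsilon}\,\mathbb{P}[M(\mathbf{X})\in O]+\delta$. The empirical covariance of $X_1,\dots,X_n\in\mathbb{R}^d$ is $\hat\Sigma=\frac1n\sum_{i=1}^n(X_i-\hat\mu)(X_i-\hat\mu)^\top=\frac1n\sum_{i=1}^nX_iX_i^\top-\hat\mu\hat\mu^\top$, where $\hat\mu=\frac1n\sum_{i=1}^nX_i$. *)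

theory Defs
  imports "HOL-Probability.Probability"
begin

text \<open>
  The dimension \<open>d\<close> is quantified after the absolute constants, so it cannot be a type.
  A vector in \<open>\<real>\<^sup>d\<close> is an extensional function on \<open>{..<d}\<close>, a \<open>d \<times> d\<close> matrix is an
  extensional function on \<open>{..<d} \<times> {..<d}\<close>, and a dataset of size \<open>n\<close> over \<open>\<X>\<close> is an
  element of \<open>{..<n} \<rightarrow>\<^sub>E \<X>\<close>.
\<close>

definition unit_ball :: "nat \<Rightarrow> (nat \<Rightarrow> real) set" where
  "unit_ball d = {x \<in> {..<d} \<rightarrow>\<^sub>E UNIV. L2_set x {..<d} \<le> 1}"

text \<open>The finite product of Borel \<open>\<sigma>\<close>-algebras is the Borel \<open>\<sigma>\<close>-algebra of \<open>\<real>\<^bsup>d\<times>d\<^esup>\<close>.\<close>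

definition matrix_space :: "nat \<Rightarrow> (nat \<times> nat \<Rightarrow> real) measure" where
  "matrix_space d = Pi\<^sub>M ({..<d} \<times> {..<d}) (\<lambda>_. borel)"

definition frobenius_dist :: "nat \<Rightarrow> (nat \<times> nat \<Rightarrow> real) \<Rightarrow> (nat \<times> nat \<Rightarrow> real) \<Rightarrow> real" where
  "frobenius_dist d S T = L2_set (\<lambda>p. S p - T p) ({..<d} \<times> {..<d})"

definition empirical_mean :: "nat \<Rightarrow> nat \<Rightarrow> (nat \<Rightarrow> nat \<Rightarrow> real) \<Rightarrow> nat \<Rightarrow> real" where
  "empirical_mean n d X = (\<lambda>a\<in>{..<d}. (1 / real n) * (\<Sum>i<n. X i a))"

definition empirical_cov :: "nat \<Rightarrow> nat \<Rightarrow> (nat \<Rightarrow> nat \<Rightarrow> real) \<Rightarrow> nat \<times> nat \<Rightarrow> real" where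
  "empirical_cov n d X = (\<lambda>(a, b)\<in>{..<d} \<times> {..<d}.
     (1 / real n) * (\<Sum>i<n. (X i a - empirical_mean n d X a) * (X i b - empirical_mean n d X b)))"

text \<open>
  A randomized algorithm sends each dataset to the distribution of its output. No measurability
  in the dataset is required. Values outside \<open>{..<n} \<rightarrow>\<^sub>E \<X>\<close> are irrelevant.
\<close>

definition randomized_algorithm ::
    "nat \<Rightarrow> 'x set \<Rightarrow> 'o measure \<Rightarrow> ((nat \<Rightarrow> 'x) \<Rightarrow> 'o measure) \<Rightarrow> bool" where
  "randomized_algorithm n \<X> \<O> M \<longleftrightarrow> M \<in> ({..<n} \<rightarrow>\<^sub>E \<X>) \<rightarrow> space (prob_algebra \<O>)"

definition neighbouring :: "nat \<Rightarrow> (nat \<Rightarrow> 'x) \<Rightarrow> (nat \<Rightarrow> 'x) \<Rightarrow> bool" where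
  "neighbouring n X X' \<longleftrightarrow> card {i \<in> {..<n}. X i \<noteq> X' i} = 1"

definition differentially_private ::
    "real \<Rightarrow> real \<Rightarrow> nat \<Rightarrow> 'x set \<Rightarrow> 'o measure \<Rightarrow> ((nat \<Rightarrow> 'x) \<Rightarrow> 'o measure) \<Rightarrow> bool" where
  "differentially_private \<epsilon> \<delta> n \<X> \<O> M \<longleftrightarrow>
     randomized_algorithm n \<X> \<O> M \<and>
     (\<forall>X \<in> {..<n} \<rightarrow>\<^sub>E \<X>. \<forall>X' \<in> {..<n} \<rightarrow>\<^sub>E \<X>. neighbouring n X X' \<longrightarrow>
        (\<forall>E \<in> sets \<O>. measure (M X') E \<le> exp \<epsilon> * measure (M X) E + \<delta>))"

text \<open>Sanity check: the second formula for the empirical covariance.\<close>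

lemma empirical_cov_alt:
  assumes "n > 0" "a < d" "b < d"
  shows "empirical_cov n d X (a, b) =
    (1 / real n) * (\<Sum>i<n. X i a * X i b) - empirical_mean n d X a * empirical_mean n d X b"
proof -
  let ?m = "empirical_mean n d X"
  have s: "(\<Sum>i<n. X i k) = real n * ?m k" if "k < d" for k
    using assms(1) that by (simp add: empirical_mean_def)
  have "(\<Sum>i<n. (X i a - ?m a) * (X i b - ?m b)) =
     (\<Sum>i<n. X i a * X i b) - (\<Sum>i<n. X i a) * ?m b - ?m a * (\<Sum>i<n. X i b) + real n * (?m a * ?m b)"
    by (simp add: algebra_simps sum.distrib sum_subtractf sum_distrib_left)
  also have "\<dots> = (\<Sum>i<n. X i a * X i b) - real n * (?m a * ?m b)"
    using s[OF assms(2)] s[OF assms(3)] by (simp add: algebra_simps)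
  finally have *: "(\<Sum>i<n. (X i a - ?m a) * (X i b - ?m b)) =
     (\<Sum>i<n. X i a * X i b) - real n * (?m a * ?m b)" .
  have "empirical_cov n d X (a, b) = (1 / real n) * (\<Sum>i<n. (X i a - ?m a) * (X i b - ?m b))"
    using assms by (simp add: empirical_cov_def)
  then show ?thesis
    unfolding * using assms(1) by (simp add: diff_divide_distrib)
qed

text \<open>The accuracy event is measurable, so \<open>measure\<close> is a genuine probability there.\<close>

lemma frobenius_ball_measurable:
  "{S \<in> space (matrix_space d). frobenius_dist d S T \<le> \<alpha>} \<in> sets (matrix_space d)"
  unfolding matrix_space_def frobenius_dist_def L2_set_def by measurable

end

theory Submission
  imports Defs
begin

text \<open>
  Split the \<open>d\<close> coordinates into \<open>p\<close> tags and \<open>q\<close> sign coordinates. A data point is a tag \<open>e\<^sub>g\<close>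
  followed by a scaled sign vector, so the cross block of the empirical covariance lists the mean
  sign vectors of \<open>p\<close> disjoint groups of \<open>k\<close> people each: estimating it is estimating \<open>p\<close>
  independent families of one-way marginals. Padding with zero points dilutes the covariance and
  turns the bound at the critical sample size \<open>p k \<approx> d powr (3/2)\<close>, where the error must be of
  the order of the whole block, into the bound \<open>d / n\<close> for larger \<open>n\<close>.

  For the marginals, draw each bias \<open>\<theta>\<close> uniformly from \<open>[-1, 1]\<close> and correlate the output with the
  centred signs of the participants. Accuracy forces a total correlation of order \<open>p q\<close>
  (fingerprinting). Privacy allows each participant to be replaced by a fresh one, for whom the
  correlation is centred with standard deviation at most \<open>sqrt q\<close>, so the total is at most of order
  \<open>p k sqrt q\<close>. Both are compatible only if \<open>k\<close> is at least of order \<open>sqrt q\<close>.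
\<close>

section \<open>Product weights on sign vectors\<close>

definition signs :: "'b set \<Rightarrow> ('b \<Rightarrow> real) set" where
  "signs B = (\<Pi>\<^sub>E b\<in>B. {-1, 1})"

text \<open>For biases in \<open>[-1, 1]\<close> this is the probability of \<open>v\<close> under
  independent signs with means \<open>\<tau> b\<close>. Expectations become finite sums against
  it.\<close>

definition row_weight :: "'b set \<Rightarrow> ('b \<Rightarrow> real) \<Rightarrow> ('b \<Rightarrow> real) \<Rightarrow> real" where
  "row_weight B \<tau> v = (\<Prod>b\<in>B. (1 + \<tau> b * v b) / 2)"

lemma finite_signs [simp]: "finite B \<Longrightarrow> finite (signs B)"
  by (simp add: signs_def finite_PiE)

lemma signs_apply: "v \<in> signs B \<Longrightarrow> b \<in> B \<Longrightarrow> v b = -1 \<or> v b = 1"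
  by (auto simp: signs_def PiE_iff)

lemma row_weight_nonneg:
  assumes "\<And>b. b \<in> B \<Longrightarrow> \<bar>\<tau> b\<bar> \<le> 1" "v \<in> signs B"
  shows "row_weight B \<tau> v \<ge> 0"
  unfolding row_weight_def
proof (rule prod_nonneg)
  fix b assume "b \<in> B"
  with assms(1)[of b] signs_apply[OF assms(2), of b] show "0 \<le> (1 + \<tau> b * v b) / 2"
    by auto
qed

text \<open>Independence as an algebraic identity. The moments below follow by letting
  \<open>h\<close> be \<open>1\<close> outside one or two coordinates.\<close>

lemma sum_row_weight_prod:
  assumes "finite B"
  shows "(\<Sum>v\<in>signs B. row_weight B \<tau> v * (\<Prod>b\<in>B. h b (v b))) =
    (\<Prod>b\<in>B. (1 - \<tau> b) / 2 * h b (-1) + (1 + \<tau> b) / 2 * h b 1)"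
proof -
  have "(\<Sum>v\<in>signs B. row_weight B \<tau> v * (\<Prod>b\<in>B. h b (v b))) =
      (\<Sum>v\<in>(\<Pi>\<^sub>E b\<in>B. {-1, 1}). \<Prod>b\<in>B. (1 + \<tau> b * v b) / 2 * h b (v b))"
    by (simp only: row_weight_def signs_def prod.distrib)
  also have "\<dots> = (\<Prod>b\<in>B. \<Sum>x\<in>{-1, 1}. (1 + \<tau> b * x) / 2 * h b x)"
    using assms by (subst prod_sum_PiE) auto
  also have "\<dots> = (\<Prod>b\<in>B. (1 - \<tau> b) / 2 * h b (-1) + (1 + \<tau> b) / 2 * h b 1)"
    by simp
  finally show ?thesis .
qed

lemma sum_row_weight: "finite B \<Longrightarrow> (\<Sum>v\<in>signs B. row_weight B \<tau> v) = 1"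
  using sum_row_weight_prod[of B \<tau> "\<lambda>_ _. 1"] by (simp add: field_simps)

lemma sum_row_weight_component:
  assumes "finite B" "b \<in> B"
  shows "(\<Sum>v\<in>signs B. row_weight B \<tau> v * v b) = \<tau> b"
proof -
  have "(\<Sum>v\<in>signs B. row_weight B \<tau> v * v b) =
      (\<Sum>v\<in>signs B. row_weight B \<tau> v * (\<Prod>a\<in>B. if a = b then v a else 1))"
    using assms by (simp add: prod.delta)
  also have "\<dots> = (\<Prod>a\<in>B. (1 - \<tau> a) / 2 * (if a = b then -1 else 1) + (1 + \<tau> a) / 2 * (if a = b then 1 else 1))"
    by (rule sum_row_weight_prod[OF assms(1), where h = "\<lambda>a x. if a = b then x else 1"])
  also have "\<dots> = (\<Prod>a\<in>B. if a = b then \<tau> a else 1)"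
    by (intro prod.cong refl) (auto simp: field_simps)
  finally show ?thesis using assms by (simp add: prod.delta)
qed

lemma sum_row_weight_covariance:
  assumes "finite B" "a \<in> B" "b \<in> B"
  shows "(\<Sum>v\<in>signs B. row_weight B \<tau> v * ((v a - \<tau> a) * (v b - \<tau> b))) = (if a = b then 1 - (\<tau> b)\<^sup>2 else 0)"
proof -
  let ?h = "\<lambda>c x. (if c = a then x - \<tau> c else 1) * (if c = b then x - \<tau> c else 1)"
  have "(\<Sum>v\<in>signs B. row_weight B \<tau> v * ((v a - \<tau> a) * (v b - \<tau> b))) =
      (\<Sum>v\<in>signs B. row_weight B \<tau> v * (\<Prod>c\<in>B. ?h c (v c)))"
    using assms by (simp add: prod.distrib prod.delta)
  also have "\<dots> = (\<Prod>c\<in>B. (1 - \<tau> c) / 2 * ?h c (-1) + (1 + \<tau> c) / 2 * ?h c 1)"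
    by (rule sum_row_weight_prod[OF assms(1)])
  also have "\<dots> = (if a = b then 1 - (\<tau> b)\<^sup>2 else 0)"
  proof (cases "a = b")
    case True
    have "(\<Prod>c\<in>B. (1 - \<tau> c) / 2 * ?h c (-1) + (1 + \<tau> c) / 2 * ?h c 1) =
        (\<Prod>c\<in>B. if c = b then 1 - (\<tau> c)\<^sup>2 else 1)"
      using True by (intro prod.cong refl) (auto simp: field_simps power2_eq_square)
    then show ?thesis using True assms by (simp add: prod.delta)
  next
    case False
    then have "(\<Prod>c\<in>B. (1 - \<tau> c) / 2 * ?h c (-1) + (1 + \<tau> c) / 2 * ?h c 1) = 0"
      using assms by (intro prod_zero bexI[of _ a]) (auto simp: field_simps)
    then show ?thesis using False by simp
  qed
  finally show ?thesis .
qed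

text \<open>Distinct coordinates are uncorrelated, so only the \<open>card B\<close> diagonal terms
  of the double sum survive, each at most 1.\<close>

lemma sum_row_weight_second_moment:
  assumes "finite B" "\<And>b. b \<in> B \<Longrightarrow> \<bar>f b\<bar> \<le> 1"
  shows "(\<Sum>v\<in>signs B. row_weight B \<tau> v * (\<Sum>b\<in>B. f b * (v b - \<tau> b))\<^sup>2) \<le> card B"
proof -
  have "(\<Sum>v\<in>signs B. row_weight B \<tau> v * (\<Sum>b\<in>B. f b * (v b - \<tau> b))\<^sup>2) =
      (\<Sum>v\<in>signs B. \<Sum>a\<in>B. \<Sum>b\<in>B. f a * f b * (row_weight B \<tau> v * ((v a - \<tau> a) * (v b - \<tau> b))))"
    by (simp add: power2_eq_square sum_product sum_distrib_left mult_ac)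
  also have "\<dots> = (\<Sum>a\<in>B. \<Sum>b\<in>B. \<Sum>v\<in>signs B. f a * f b * (row_weight B \<tau> v * ((v a - \<tau> a) * (v b - \<tau> b))))"
    by (subst sum.swap) (intro sum.cong refl sum.swap)
  also have "\<dots> = (\<Sum>a\<in>B. \<Sum>b\<in>B. f a * f b * (if a = b then 1 - (\<tau> b)\<^sup>2 else 0))"
    using assms(1) by (simp add: sum_distrib_left[symmetric] sum_row_weight_covariance)
  also have "\<dots> = (\<Sum>a\<in>B. (f a)\<^sup>2 * (1 - (\<tau> a)\<^sup>2))"
    using assms(1) by (simp add: if_distrib sum.delta power2_eq_square cong: if_cong)
  also have "\<dots> \<le> (\<Sum>a\<in>B. 1)"
  proof (rule sum_mono)
    fix a assume "a \<in> B"
    then have "(f a)\<^sup>2 \<le> 1" using assms(2) by (simp add: abs_square_le_1)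
    moreover have "(f a)\<^sup>2 * (1 - (\<tau> a)\<^sup>2) \<le> (f a)\<^sup>2 * 1" by (intro mult_left_mono) auto
    ultimately show "(f a)\<^sup>2 * (1 - (\<tau> a)\<^sup>2) \<le> 1" by simp
  qed
  finally show ?thesis by simp
qed

text \<open>This is the size of the correlation between an output and a row independent of it:
  fluctuations add up to \<open>sqrt (card B)\<close> instead of \<open>card B\<close>.\<close>

lemma sum_row_weight_abs:
  assumes "finite B" "\<And>b. b \<in> B \<Longrightarrow> \<bar>f b\<bar> \<le> 1" "\<And>b. b \<in> B \<Longrightarrow> \<bar>\<tau> b\<bar> \<le> 1"
  shows "(\<Sum>v\<in>signs B. row_weight B \<tau> v * \<bar>\<Sum>b\<in>B. f b * (v b - \<tau> b)\<bar>) \<le> sqrt (card B)"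
proof (cases "B = {}")
  case True
  then show ?thesis by simp
next
  case False
  define s where "s = sqrt (card B)"
  have s: "s > 0" "s\<^sup>2 = card B" using False assms(1) by (simp_all add: s_def card_gt_0_iff)
  \<comment> \<open>AM-GM stands in for Cauchy-Schwarz; balancing at
    \<open>s = sqrt (card B)\<close> bounds each half by \<open>s / 2\<close>.\<close>
  have amgm: "\<bar>x\<bar> \<le> (x\<^sup>2 / s + s) / 2" for x :: real
  proof -
    have "0 \<le> (\<bar>x\<bar> - s)\<^sup>2" by simp
    then show ?thesis using s(1) by (simp add: field_simps power2_eq_square)
  qed
  have "(\<Sum>v\<in>signs B. row_weight B \<tau> v * \<bar>\<Sum>b\<in>B. f b * (v b - \<tau> b)\<bar>) \<le>
      (\<Sum>v\<in>signs B. row_weight B \<tau> v * (((\<Sum>b\<in>B. f b * (v b - \<tau> b))\<^sup>2 / s + s) / 2))"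
    by (intro sum_mono mult_left_mono amgm row_weight_nonneg assms(3))
  also have "\<dots> = (\<Sum>v\<in>signs B. row_weight B \<tau> v * (\<Sum>b\<in>B. f b * (v b - \<tau> b))\<^sup>2) / (2 * s)
      + s / 2 * (\<Sum>v\<in>signs B. row_weight B \<tau> v)"
    by (simp add: algebra_simps add_divide_distrib sum.distrib sum_divide_distrib sum_distrib_left)
  also have "\<dots> \<le> card B / (2 * s) + s / 2 * 1"
    using s(1) assms(1,2) by (intro add_mono divide_right_mono sum_row_weight_second_moment) (auto simp: sum_row_weight)
  also have "\<dots> = s" using s by (simp add: field_simps power2_eq_square)
  finally show ?thesis by (simp add: s_def)
qed

section \<open>Resampling one row of a random dataset\<close>

text \<open>Draw a fresh \<open>v\<close> and exchange it with row \<open>i\<close>. The pair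
  \<open>(V, v)\<close> keeps its joint weight, so a term in which \<open>\<Psi>\<close> sees a
  dataset without the row under test becomes an average over a row independent of
  \<open>V\<close>.\<close>

lemma sum_PiE_resample:
  fixes w :: "'i \<Rightarrow> 'v \<Rightarrow> real"
  assumes "finite I" "i \<in> I"
    and w1: "(\<Sum>v\<in>S. w i v) = 1"
    and w0: "\<And>j v. j \<in> I \<Longrightarrow> v \<in> S \<Longrightarrow> 0 \<le> w j v"
    and le: "\<And>V v. V \<in> I \<rightarrow>\<^sub>E S \<Longrightarrow> v \<in> S \<Longrightarrow> \<Phi> V (V i) \<le> \<Psi> (V(i := v)) (V i)"
  shows "(\<Sum>V\<in>I \<rightarrow>\<^sub>E S. (\<Prod>j\<in>I. w j (V j)) * \<Phi> V (V i)) \<le>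
    (\<Sum>V\<in>I \<rightarrow>\<^sub>E S. (\<Prod>j\<in>I. w j (V j)) * (\<Sum>v\<in>S. w i v * \<Psi> V v))"
proof -
  let ?P = "\<lambda>V. \<Prod>j\<in>I. w j (V j)"
  have P: "?P (V(i := v)) = w i v * (\<Prod>j\<in>I-{i}. w j (V j))" for V v
    using assms(1,2) by (subst prod.remove[of I i]) (auto intro!: prod.cong)
  have P': "?P V = w i (V i) * (\<Prod>j\<in>I-{i}. w j (V j))" for V
    using P[of V "V i"] by simp
  have "(\<Sum>V\<in>I \<rightarrow>\<^sub>E S. ?P V * \<Phi> V (V i)) = (\<Sum>V\<in>I \<rightarrow>\<^sub>E S. \<Sum>v\<in>S. ?P V * w i v * \<Phi> V (V i))"
    by (simp add: sum_distrib_left[symmetric] sum_distrib_right[symmetric] w1)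
  also have "\<dots> \<le> (\<Sum>V\<in>I \<rightarrow>\<^sub>E S. \<Sum>v\<in>S. ?P V * w i v * \<Psi> (V(i := v)) (V i))"
    using assms(2) by (intro sum_mono mult_left_mono le mult_nonneg_nonneg prod_nonneg w0) (auto simp: PiE_iff)
  also have "\<dots> = (\<Sum>(V, v)\<in>(I \<rightarrow>\<^sub>E S) \<times> S. ?P V * w i v * \<Psi> (V(i := v)) (V i))"
    by (simp add: sum.cartesian_product)
  \<comment> \<open>The exchange is an involution, and \<open>?P V * w i v\<close> is symmetric in
    \<open>V i\<close> and \<open>v\<close>.\<close>
  also have "\<dots> = (\<Sum>(V, v)\<in>(I \<rightarrow>\<^sub>E S) \<times> S. ?P V * w i v * \<Psi> V v)"
    using assms(2)
    by (intro sum.reindex_bij_witness[where i = "\<lambda>(V, v). (V(i := v), V i)" and j = "\<lambda>(V, v). (V(i := v), V i)"])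
       (auto simp: PiE_iff P P' extensional_def)
  also have "\<dots> = (\<Sum>V\<in>I \<rightarrow>\<^sub>E S. ?P V * (\<Sum>v\<in>S. w i v * \<Psi> V v))"
    by (simp add: sum.cartesian_product[symmetric] sum_distrib_left mult_ac)
  finally show ?thesis .
qed

lemma sum_PiE_marginal:
  fixes w :: "'i \<Rightarrow> 'v \<Rightarrow> real"
  assumes "finite I" "finite S" "i \<in> I" "\<And>j. j \<in> I \<Longrightarrow> (\<Sum>v\<in>S. w j v) = 1"
  shows "(\<Sum>V\<in>I \<rightarrow>\<^sub>E S. (\<Prod>j\<in>I. w j (V j)) * g (V i)) = (\<Sum>v\<in>S. w i v * g v)"
proof -
  have "(\<Sum>V\<in>I \<rightarrow>\<^sub>E S. (\<Prod>j\<in>I. w j (V j)) * g (V i)) =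
      (\<Sum>V\<in>I \<rightarrow>\<^sub>E S. \<Prod>j\<in>I. w j (V j) * (if j = i then g (V j) else 1))"
    using assms(1,3) by (simp add: prod.distrib)
  also have "\<dots> = (\<Prod>j\<in>I. \<Sum>v\<in>S. w j v * (if j = i then g v else 1))"
    using assms(1,2) by (intro prod_sum_PiE[symmetric]) auto
  also have "\<dots> = (\<Prod>j\<in>I. if j = i then (\<Sum>v\<in>S. w i v * g v) else 1)"
    using assms(4) by (intro prod.cong refl) auto
  finally show ?thesis using assms(1,3) by simp
qed

section \<open>Approximate differential privacy for expectations\<close>

text \<open>Layer-cake argument: \<open>\<phi>\<close> is rounded down to \<open>b / m\<close> times
  a sum of indicators of level sets, and the hypothesis on events is applied to each level. The
  \<open>m\<close> additive errors sum to \<open>b * \<delta>\<close>, and the rounding error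
  \<open>b / m\<close> vanishes as \<open>m\<close> grows.\<close>

lemma integral_approx_DP:
  fixes \<phi> :: "'a \<Rightarrow> real"
  assumes "prob_space N" "prob_space N'" "sets N = sets \<O>" "sets N' = sets \<O>"
    and meas: "\<phi> \<in> borel_measurable \<O>"
    and bnd: "\<And>x. x \<in> space \<O> \<Longrightarrow> 0 \<le> \<phi> x \<and> \<phi> x \<le> b"
    and b: "0 \<le> b" and c: "0 \<le> c"
    and dp: "\<And>E. E \<in> sets \<O> \<Longrightarrow> measure N E \<le> c * measure N' E + \<delta>"
  shows "(\<integral>x. \<phi> x \<partial>N) \<le> c * (\<integral>x. \<phi> x \<partial>N') + b * \<delta>"
proof (cases "b = 0")
  case True
  then have "(\<integral>x. \<phi> x \<partial>K) = 0" if "sets K = sets \<O>" for K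
    using bnd sets_eq_imp_space_eq[OF that]
    by (intro integral_eq_zero_AE AE_I2) (auto intro: antisym)
  then show ?thesis using assms(3,4) True by simp
next
  case False
  with b have b: "b > 0" by simp
  define step where "step = (\<lambda>m x. b / real m * (\<Sum>j=1..m. indicator {x \<in> space \<O>. b * real j / real m \<le> \<phi> x} x))"
  have step: "step m x \<le> \<phi> x \<and> \<phi> x \<le> step m x + b / m" if m: "m > 0" and x: "x \<in> space \<O>" for m x
  proof -
    \<comment> \<open>In units of \<open>b / m\<close>, the rounded value is the floor of
      \<open>y\<close>.\<close>
    define y where "y = \<phi> x * m / b"
    have y: "0 \<le> y" "y \<le> m" using bnd[OF x] b m by (simp_all add: y_def field_simps)
    have "(\<Sum>j=1..m. indicator {x \<in> space \<O>. b * real j / real m \<le> \<phi> x} x) =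
        (\<Sum>j=1..m. if real j \<le> y then 1 else (0::real))"
    proof (intro sum.cong refl)
      fix j
      have "b * real j / real m \<le> \<phi> x \<longleftrightarrow> real j \<le> y"
        using b m by (simp add: y_def field_simps)
      then show "indicator {x \<in> space \<O>. b * real j / real m \<le> \<phi> x} x = (if real j \<le> y then 1 else (0::real))"
        using x by (simp add: indicator_def)
    qed
    also have "\<dots> = real (card {j \<in> {1..m}. real j \<le> y})"
      by (simp only: sum.inter_filter[symmetric] finite_atLeastAtMost sum_constant mult_1_right)
    also have "{j \<in> {1..m}. real j \<le> y} = {1..nat \<lfloor>y\<rfloor>}"
    proof (intro set_eqI)
      fix j
      have "j \<le> nat \<lfloor>y\<rfloor> \<longleftrightarrow> real j \<le> y" using y by linarith
      then show "j \<in> {j \<in> {1..m}. real j \<le> y} \<longleftrightarrow> j \<in> {1..nat \<lfloor>y\<rfloor>}"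
        using y by (auto intro: order_trans simp flip: of_nat_le_iff)
    qed
    also have "real (card {1..nat \<lfloor>y\<rfloor>}) = \<lfloor>y\<rfloor>" using y by simp
    finally have s: "step m x = b / m * \<lfloor>y\<rfloor>" by (simp add: step_def)
    have "\<phi> x = b / m * y" using b m by (simp add: y_def)
    moreover have "b / m * \<lfloor>y\<rfloor> \<le> b / m * y" "b / m * y \<le> b / m * (\<lfloor>y\<rfloor> + 1)"
      using b by (intro mult_left_mono; simp add: less_imp_le)+
    ultimately show ?thesis using s by (simp add: algebra_simps)
  qed
  have lvl: "{x \<in> space \<O>. b * real j / real m \<le> \<phi> x} \<in> sets \<O>" for j m
    using meas by measurable
  have int: "(\<integral>x. step m x \<partial>K) = b / m * (\<Sum>j=1..m. measure K {x \<in> space \<O>. b * real j / real m \<le> \<phi> x})"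
    "integrable K (step m)" "integrable K \<phi>" if "prob_space K" "sets K = sets \<O>" for K m
  proof -
    interpret K: prob_space K by fact
    have l: "{x \<in> space \<O>. b * real j / real m \<le> \<phi> x} \<in> sets K" for j using lvl that by simp
    then show "(\<integral>x. step m x \<partial>K) = b / m * (\<Sum>j=1..m. measure K {x \<in> space \<O>. b * real j / real m \<le> \<phi> x})"
      unfolding step_def
      by (subst integral_mult_right_zero, subst Bochner_Integration.integral_sum) (auto simp: K.emeasure_finite less_top[symmetric])
    show "integrable K (step m)" unfolding step_def using l
      by (intro integrable_mult_right Bochner_Integration.integrable_sum) (auto simp: K.emeasure_finite less_top[symmetric])
    show "integrable K \<phi>"
      using bnd sets_eq_imp_space_eq[OF that(2)] meas that(2)
      by (intro K.integrable_const_bound[where B = b] AE_I2) (auto cong: measurable_cong_sets)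
  qed
  have sp: "space N = space \<O>" "space N' = space \<O>" using assms(3,4) sets_eq_imp_space_eq by blast+
  interpret N: prob_space N by fact
  interpret N': prob_space N' by fact
  have main: "(\<integral>x. \<phi> x \<partial>N) \<le> (c * (\<integral>x. \<phi> x \<partial>N') + b * \<delta>) + b / m" if m: "m > 0" for m :: nat
  proof -
    have "(\<integral>x. \<phi> x \<partial>N) \<le> (\<integral>x. step m x + b / m \<partial>N)"
      using step[OF m] int[OF assms(1,3)] sp by (intro integral_mono) auto
    also have "\<dots> = (\<integral>x. step m x \<partial>N) + b / m"
      using int[OF assms(1,3)] by (simp add: N.prob_space)
    also have "(\<integral>x. step m x \<partial>N) \<le> b / m * (\<Sum>j=1..m. c * measure N' {x \<in> space \<O>. b * real j / real m \<le> \<phi> x} + \<delta>)"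
      unfolding int(1)[OF assms(1,3)] using b by (intro mult_left_mono sum_mono dp lvl) auto
    also have "\<dots> = c * (\<integral>x. step m x \<partial>N') + b * \<delta>"
      unfolding int(1)[OF assms(2,4)] using m by (simp add: sum.distrib algebra_simps sum_distrib_left)
    also have "(\<integral>x. step m x \<partial>N') \<le> (\<integral>x. \<phi> x \<partial>N')"
      using step[OF m] int[OF assms(2,4)] sp by (intro integral_mono) auto
    finally show ?thesis using c by (simp add: mult_left_mono)
  qed
  show ?thesis
  proof (rule LIMSEQ_le_const)
    show "(\<lambda>m. (c * (\<integral>x. \<phi> x \<partial>N') + b * \<delta>) + b / real (Suc m)) \<longlonglongrightarrow> c * (\<integral>x. \<phi> x \<partial>N') + b * \<delta>"
      using tendsto_add[OF tendsto_const, of "\<lambda>m. b / real (Suc m)" 0] LIMSEQ_Suc[OF lim_const_over_n[of b]] by simp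
    show "\<exists>N0. \<forall>m\<ge>N0. (\<integral>x. \<phi> x \<partial>N) \<le> (c * (\<integral>x. \<phi> x \<partial>N') + b * \<delta>) + b / real (Suc m)"
      using main by blast
  qed
qed

section \<open>The fingerprinting identity\<close>

definition uniform_prior :: "real measure" where
  "uniform_prior = density lborel (\<lambda>t. ennreal (indicator {-1..1} t / 2))"

lemma sets_uniform_prior [simp, measurable_cong]: "sets uniform_prior = sets borel"
  by (simp add: uniform_prior_def)

lemma space_uniform_prior [simp]: "space uniform_prior = UNIV"
  by (simp add: uniform_prior_def)

lemma prob_space_uniform_prior: "prob_space uniform_prior"
proof
  have "emeasure uniform_prior (space uniform_prior) = (\<integral>\<^sup>+t. ennreal (1 / 2) * indicator {-1..1::real} t \<partial>lborel)"
    unfolding uniform_prior_def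
    by (subst emeasure_density) (auto intro!: nn_integral_cong split: split_indicator)
  also have "\<dots> = ennreal (1 / 2) * ennreal 2"
    by (subst nn_integral_cmult_indicator) auto
  also have "\<dots> = 1"
    by (subst ennreal_mult[symmetric]) auto
  finally show "emeasure uniform_prior (space uniform_prior) = 1" .
qed

lemma AE_uniform_prior: "AE t in uniform_prior. \<bar>t\<bar> \<le> 1"
  unfolding uniform_prior_def by (subst AE_density) (auto split: split_indicator simp: indicator_def)

lemma integrable_uniform_prior:
  assumes "continuous_on UNIV f"
  shows "integrable uniform_prior (f :: real \<Rightarrow> real)"
proof -
  have [measurable]: "f \<in> borel_measurable borel" using assms by (rule borel_measurable_continuous_onI)
  have "integrable lborel (\<lambda>t. indicator {-1..1} t *\<^sub>R f t)"
    using borel_integrable_atLeastAtMost'[of "-1" 1 f] continuous_on_subset[OF assms] unfolding set_integrable_def by simp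
  then have "integrable lborel (\<lambda>t. (1/2) *\<^sub>R (indicator {-1..1} t *\<^sub>R f t))"
    by (rule integrable_scaleR_right)
  then show ?thesis unfolding uniform_prior_def
    by (subst integrable_density) (auto simp: field_simps)
qed

lemma integral_uniform_prior_derivative:
  assumes "\<And>t. (F has_real_derivative f t) (at t)" "continuous_on UNIV f"
  shows "(\<integral>t. f t \<partial>uniform_prior) = (F 1 - F (-1)) / 2"
proof -
  have [measurable]: "f \<in> borel_measurable borel" using assms(2) by (rule borel_measurable_continuous_onI)
  have "(\<integral>t. f t \<partial>uniform_prior) = (\<integral>t. (1/2) *\<^sub>R (indicator {-1..1} t *\<^sub>R f t) \<partial>lborel)"
    unfolding uniform_prior_def by (subst integral_density) (auto simp: field_simps)
  also have "\<dots> = (1/2) *\<^sub>R (\<integral>t. indicator {-1..1} t *\<^sub>R f t \<partial>lborel)"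
    by (rule integral_scaleR_right)
  also have "(\<integral>t. indicator {-1..1} t *\<^sub>R f t \<partial>lborel) = F 1 - F (-1)"
    using assms continuous_on_subset[OF assms(2)]
    by (intro integral_FTC_atLeastAtMost) (auto simp: has_real_derivative_iff_has_vector_derivative[symmetric] intro: has_field_derivative_at_within)
  finally show ?thesis by simp
qed

lemma integral_uniform_prior_square: "(\<integral>t. t\<^sup>2 \<partial>uniform_prior) = 1 / 3"
proof -
  have "((\<lambda>t. t ^ 3 / 3) has_real_derivative t\<^sup>2) (at t)" for t :: real
    by (auto intro!: derivative_eq_intros)
  from integral_uniform_prior_derivative[OF this] show ?thesis by (simp add: continuous_intros)
qed

text \<open>
  The weight \<open>(1 - t\<^sup>2) \<Prod>(1 + t c\<^sub>i) / 2\<close> vanishes at both ends of the prior, so its derivative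
  integrates to \<open>0\<close>. This replaces the integration by parts of the usual fingerprinting lemma.
\<close>
lemma derivative_sign_weight:
  fixes c :: "'a \<Rightarrow> real"
  assumes "finite A" "\<And>i. i \<in> A \<Longrightarrow> c i = -1 \<or> c i = 1"
  shows "((\<lambda>t. (1 - t\<^sup>2) * (\<Prod>i\<in>A. (1 + t * c i) / 2)) has_real_derivative
    (\<Prod>i\<in>A. (1 + t * c i) / 2) * ((\<Sum>i\<in>A. c i) - (real (card A) + 2) * t)) (at t)"
  using assms
proof (induction A)
  case empty
  show ?case by (auto intro!: derivative_eq_intros simp: algebra_simps)
next
  case (insert i A)
  let ?P = "\<lambda>t. \<Prod>i\<in>A. (1 + t * c i) / 2"
  have IH: "((\<lambda>t. (1 - t\<^sup>2) * ?P t) has_real_derivative ?P t * ((\<Sum>i\<in>A. c i) - (real (card A) + 2) * t)) (at t)"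
    using insert by auto
  have c: "(c i)\<^sup>2 = 1" using insert.prems[of i] by auto
  have deriv: "((\<lambda>t. (1 - t\<^sup>2) * ?P t * ((1 + t * c i) / 2)) has_real_derivative
     ?P t * ((\<Sum>i\<in>A. c i) - (real (card A) + 2) * t) * ((1 + t * c i) / 2) + (c i / 2) * ((1 - t\<^sup>2) * ?P t)) (at t)"
    by (rule DERIV_mult[OF IH]) (auto intro!: derivative_eq_intros)
  have "c i * (1 - t\<^sup>2) = (1 + t * c i) * (c i - t)"
    using c by (simp add: algebra_simps power2_eq_square)
  then have eq: "(c i / 2) * ((1 - t\<^sup>2) * p) = p * ((1 + t * c i) / 2) * (c i - t)" for p
    by (metis (no_types, opaque_lifting) mult.commute mult.left_commute times_divide_eq_left)
  have "p * (s - (m + 2) * t) * ((1 + t * c i) / 2) + (c i / 2) * ((1 - t\<^sup>2) * p) =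
      (1 + t * c i) / 2 * p * (c i + s - (m + 1 + 2) * t)" for p s m :: real
    unfolding eq by (simp add: field_simps)
  note deriv[unfolded this]
  moreover have "(\<lambda>t. (1 - t\<^sup>2) * (\<Prod>j\<in>insert i A. (1 + t * c j) / 2)) =
      (\<lambda>t. (1 - t\<^sup>2) * ?P t * ((1 + t * c i) / 2))"
    using insert.hyps by (simp add: mult_ac)
  moreover have "real (card (insert i A)) = real (card A) + 1"
    using insert.hyps by simp
  ultimately show ?case
    using insert.hyps by (simp only: prod.insert sum.insert if_False simp_thms)
qed

lemma integral_uniform_prior_sign_weight:
  fixes c :: "'a \<Rightarrow> real"
  assumes "finite A" "\<And>i. i \<in> A \<Longrightarrow> c i = -1 \<or> c i = 1"
  shows "(\<integral>t. (\<Prod>i\<in>A. (1 + t * c i) / 2) * ((\<Sum>i\<in>A. c i) - (real (card A) + 2) * t) \<partial>uniform_prior) = 0"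
  by (subst integral_uniform_prior_derivative[OF derivative_sign_weight[OF assms]]) (auto intro!: continuous_intros)

section \<open>From accuracy to correlation\<close>

text \<open>On the accuracy event, Cauchy-Schwarz keeps the correlation within
  \<open>\<rho> * sqrt (card J)\<close> of the squared norm of \<open>y\<close>. On its complement,
  of probability at most \<open>1 / 4\<close>, boundedness of \<open>F\<close> still gives at least
  minus the sum of the absolute values of \<open>y\<close>.\<close>

lemma accurate_correlation_ge:
  assumes "prob_space N" "sets N = sets \<O>"
    and F: "\<And>x. (\<lambda>s. F s x) \<in> borel_measurable \<O>" "\<And>s x. \<bar>F s x\<bar> \<le> 1"
    and A: "A \<in> sets \<O>" "measure N A \<ge> 3 / 4"
    and close: "\<And>s. s \<in> A \<Longrightarrow> (\<Sum>x\<in>J. (F s x - y x)\<^sup>2) \<le> \<rho>\<^sup>2"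
    and y: "\<And>x. x \<in> J \<Longrightarrow> \<bar>y x\<bar> \<le> 1" and \<rho>: "\<rho> \<ge> 0" and J: "finite J"
  shows "(\<Sum>x\<in>J. (\<integral>s. F s x \<partial>N) * y x) \<ge> 1 / 2 * (\<Sum>x\<in>J. (y x)\<^sup>2) - card J / 16 - \<rho> * sqrt (card J)"
proof -
  interpret N: prob_space N by fact
  let ?S = "\<Sum>x\<in>J. (y x)\<^sup>2"
  define T where "T = (\<Sum>x\<in>J. \<bar>y x\<bar>)"
  have Fint: "integrable N (\<lambda>s. F s x)" for x
    using F assms(2) by (intro N.integrable_const_bound[where B = 1]) (auto cong: measurable_cong_sets)
  have S: "?S \<le> card J"
    using sum_bounded_above[of J "\<lambda>x. (y x)\<^sup>2" 1] y by (simp add: abs_square_le_1)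
  have T0: "T \<ge> 0" by (simp add: T_def sum_nonneg)
  \<comment> \<open>Completing the square at \<open>1 / 2\<close>. The failure loss
    \<open>T / 4\<close> then costs a quarter of \<open>?S\<close> plus \<open>card J / 16\<close>,
    and of \<open>3 / 4 * ?S\<close> one half remains.\<close>
  have T: "T \<le> ?S + card J / 4"
  proof -
    have "\<bar>a\<bar> \<le> a\<^sup>2 + 1 / 4" for a :: real
      using zero_le_power2[of "\<bar>a\<bar> - 1 / 2"] by (simp add: power2_eq_square algebra_simps)
    then have "T \<le> (\<Sum>x\<in>J. (y x)\<^sup>2 + 1 / 4)"
      unfolding T_def by (intro sum_mono)
    then show ?thesis by (simp add: sum.distrib)
  qed
  have fail: "- T \<le> (\<Sum>x\<in>J. F s x * y x)" for s
  proof -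
    have "- \<bar>y x\<bar> \<le> F s x * y x" for x
      using mult_right_mono[OF F(2)[of s x], of "\<bar>y x\<bar>"] by (simp add: abs_mult[symmetric])
    then have "(\<Sum>x\<in>J. - \<bar>y x\<bar>) \<le> (\<Sum>x\<in>J. F s x * y x)" by (intro sum_mono)
    then show ?thesis by (simp add: T_def sum_negf)
  qed
  have succ: "?S - \<rho> * sqrt (card J) \<le> (\<Sum>x\<in>J. F s x * y x)" if "s \<in> A" for s
  proof -
    have "\<bar>\<Sum>x\<in>J. (F s x - y x) * y x\<bar> \<le> (\<Sum>x\<in>J. \<bar>F s x - y x\<bar> * \<bar>y x\<bar>)"
      unfolding abs_mult[symmetric] by (rule sum_abs)
    also have "\<dots> \<le> L2_set (\<lambda>x. F s x - y x) J * L2_set y J"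
      by (rule L2_set_mult_ineq)
    also have "\<dots> \<le> \<rho> * sqrt (card J)"
      using close[OF that] S \<rho> unfolding L2_set_def
      by (intro mult_mono) (auto intro: real_le_lsqrt sum_nonneg)
    finally have "\<bar>\<Sum>x\<in>J. (F s x - y x) * y x\<bar> \<le> \<rho> * sqrt (card J)" .
    moreover have "(\<Sum>x\<in>J. (F s x - y x) * y x) = (\<Sum>x\<in>J. F s x * y x) - ?S"
      by (simp add: algebra_simps sum_subtractf power2_eq_square)
    ultimately show ?thesis by linarith
  qed
  have AN: "A \<in> sets N" using A assms(2) by simp
  have "measure N A * (?S + T) - \<rho> * sqrt (card J) - T \<le>
      measure N A * (?S - \<rho> * sqrt (card J) + T) - T"
    using mult_right_mono[OF N.prob_le_1[of A], of "\<rho> * sqrt (card J)"] \<rho> by (simp add: algebra_simps)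
  also have "\<dots> = (\<integral>s. indicator A s * (?S - \<rho> * sqrt (card J) + T) - T \<partial>N)"
    using AN by (subst Bochner_Integration.integral_diff)
      (auto simp: N.prob_space N.emeasure_finite less_top[symmetric] intro!: integrable_mult_left)
  also have "\<dots> \<le> (\<integral>s. (\<Sum>x\<in>J. F s x * y x) \<partial>N)"
    using AN Fint succ fail
    by (intro integral_mono Bochner_Integration.integrable_diff integrable_mult_left)
      (auto simp: N.emeasure_finite less_top[symmetric] split: split_indicator)
  also have "\<dots> = (\<Sum>x\<in>J. (\<integral>s. F s x \<partial>N) * y x)"
    using Fint by (simp add: Bochner_Integration.integral_sum)
  finally have "measure N A * (?S + T) - \<rho> * sqrt (card J) - T \<le> (\<Sum>x\<in>J. (\<integral>s. F s x \<partial>N) * y x)" .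
  moreover have "3 / 4 * (?S + T) \<le> measure N A * (?S + T)"
    using A(2) T0 by (intro mult_right_mono) (auto intro!: add_nonneg_nonneg sum_nonneg)
  ultimately show ?thesis using T by (simp add: algebra_simps)
qed

section \<open>Random datasets with grouped rows\<close>

text \<open>\<open>I\<close> indexes the participants, \<open>G\<close> the groups and
  \<open>B\<close> the attributes. A pair \<open>(g, b)\<close> is one marginal to be estimated,
  averaged over the \<open>k\<close> members of \<open>g\<close>.\<close>

locale grouped_signs =
  fixes I :: "'i set" and B :: "'b set" and G :: "'g set" and grp :: "'i \<Rightarrow> 'g" and k :: nat
  assumes finite_I [simp]: "finite I" and finite_B [simp]: "finite B" and finite_G [simp]: "finite G"
    and grp: "i \<in> I \<Longrightarrow> grp i \<in> G"
    and card_members: "g \<in> G \<Longrightarrow> card {i \<in> I. grp i = g} = k"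
    and k_pos: "k > 0"
begin

definition members :: "'g \<Rightarrow> 'i set" where
  "members g = {i \<in> I. grp i = g}"

definition datasets :: "('i \<Rightarrow> 'b \<Rightarrow> real) set" where
  "datasets = (I \<rightarrow>\<^sub>E signs B)"

text \<open>Likelihood of the dataset \<open>V\<close> given the biases; all members of a group
  share theirs.\<close>

definition weight :: "('g \<times> 'b \<Rightarrow> real) \<Rightarrow> ('i \<Rightarrow> 'b \<Rightarrow> real) \<Rightarrow> real" where
  "weight \<theta> V = (\<Prod>i\<in>I. row_weight B (\<lambda>b. \<theta> (grp i, b)) (V i))"

definition avg :: "('i \<Rightarrow> 'b \<Rightarrow> real) \<Rightarrow> 'g \<times> 'b \<Rightarrow> real" where
  "avg V x = (\<Sum>i\<in>members (fst x). V i (snd x)) / k"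

text \<open>The fingerprinting statistic; \<open>f\<close> stands for the expected output of the
  algorithm.\<close>

definition score :: "('g \<times> 'b \<Rightarrow> real) \<Rightarrow> ('i \<Rightarrow> 'b \<Rightarrow> real) \<Rightarrow> ('g \<times> 'b \<Rightarrow> real) \<Rightarrow> real" where
  "score \<theta> V f = (\<Sum>i\<in>I. \<Sum>b\<in>B. f (grp i, b) * (V i b - \<theta> (grp i, b)))"

definition prior :: "('g \<times> 'b \<Rightarrow> real) measure" where
  "prior = Pi\<^sub>M (G \<times> B) (\<lambda>_. uniform_prior)"

text \<open>Marginal probability of \<open>V\<close> once the biases are drawn from the
  prior.\<close>

definition mix :: "('i \<Rightarrow> 'b \<Rightarrow> real) \<Rightarrow> real" where
  "mix V = (\<integral>\<theta>. weight \<theta> V \<partial>prior)"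

lemma finite_members [simp]: "finite (members g)"
  by (simp add: members_def)

lemma finite_datasets [simp]: "finite datasets"
  by (simp add: datasets_def finite_PiE)

lemma datasets_apply: "V \<in> datasets \<Longrightarrow> i \<in> I \<Longrightarrow> V i \<in> signs B"
  by (auto simp: datasets_def)

lemma weight_nonneg:
  assumes "\<And>x. x \<in> G \<times> B \<Longrightarrow> \<bar>\<theta> x\<bar> \<le> 1" "V \<in> datasets"
  shows "weight \<theta> V \<ge> 0"
  unfolding weight_def using assms grp
  by (intro prod_nonneg row_weight_nonneg datasets_apply) auto

lemma sum_weight: "(\<Sum>V\<in>datasets. weight \<theta> V) = 1"
proof -
  have "(\<Sum>V\<in>datasets. weight \<theta> V) = (\<Prod>i\<in>I. \<Sum>v\<in>signs B. row_weight B (\<lambda>b. \<theta> (grp i, b)) v)"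
    unfolding datasets_def weight_def by (intro prod_sum_PiE[symmetric]) auto
  then show ?thesis by (simp add: sum_row_weight)
qed

lemma sum_weight_component:
  assumes "i \<in> I" "b \<in> B"
  shows "(\<Sum>V\<in>datasets. weight \<theta> V * V i b) = \<theta> (grp i, b)"
  unfolding datasets_def weight_def
  using assms by (subst sum_PiE_marginal[where g = "\<lambda>v. v b"]) (auto simp: sum_row_weight sum_row_weight_component)

lemma sum_weight_avg:
  assumes "x \<in> G \<times> B"
  shows "(\<Sum>V\<in>datasets. weight \<theta> V * avg V x) = \<theta> x"
proof -
  have "(\<Sum>V\<in>datasets. weight \<theta> V * avg V x) =
      (\<Sum>i\<in>members (fst x). \<Sum>V\<in>datasets. weight \<theta> V * V i (snd x)) / k"
    unfolding avg_def by (subst sum.swap) (simp add: sum_divide_distrib sum_distrib_left)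
  also have "\<dots> = (\<Sum>i\<in>members (fst x). \<theta> x) / k"
    using assms by (intro arg_cong2[where f = "(/)"] sum.cong refl) (auto simp: members_def sum_weight_component)
  also have "\<dots> = \<theta> x"
    using assms k_pos card_members by (auto simp: members_def)
  finally show ?thesis .
qed

text \<open>Rearranging by bias instead of by row exhibits the likelihood as a product of functions
  of single biases \<open>\<theta> x\<close>, so integrals over the product prior split into
  one-dimensional ones.\<close>

lemma weight_eq:
  "weight \<theta> V = (\<Prod>x\<in>G \<times> B. \<Prod>i\<in>members (fst x). (1 + \<theta> x * V i (snd x)) / 2)"
proof -
  have "(\<Prod>x\<in>G \<times> B. \<Prod>i\<in>members (fst x). (1 + \<theta> x * V i (snd x)) / 2) =
      (\<Prod>g\<in>G. \<Prod>b\<in>B. \<Prod>i\<in>members g. (1 + \<theta> (g, b) * V i b) / 2)"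
    by (subst prod.cartesian_product) (auto intro!: prod.cong)
  also have "\<dots> = (\<Prod>g\<in>G. \<Prod>i\<in>members g. row_weight B (\<lambda>b. \<theta> (grp i, b)) (V i))"
    unfolding row_weight_def by (intro prod.cong refl, subst prod.swap) (auto simp: members_def)
  also have "\<dots> = weight \<theta> V"
    unfolding weight_def members_def using grp by (intro prod.group) auto
  finally show ?thesis ..
qed

lemma score_eq:
  fixes \<theta> :: "'g \<times> 'b \<Rightarrow> real"
  shows "score \<theta> V f = (\<Sum>x\<in>G \<times> B. f x * (k * avg V x - k * \<theta> x))"
proof -
  have "score \<theta> V f = (\<Sum>g\<in>G. \<Sum>i\<in>members g. \<Sum>b\<in>B. f (grp i, b) * (V i b - \<theta> (grp i, b)))"
    unfolding score_def members_def using grp by (intro sum.group[symmetric]) auto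
  also have "\<dots> = (\<Sum>g\<in>G. \<Sum>b\<in>B. \<Sum>i\<in>members g. f (g, b) * (V i b - \<theta> (g, b)))"
    by (intro sum.cong refl, subst sum.swap) (auto simp: members_def)
  also have "\<dots> = (\<Sum>g\<in>G. \<Sum>b\<in>B. f (g, b) * (k * avg V (g, b) - k * \<theta> (g, b)))"
    using k_pos card_members by (intro sum.cong refl)
      (simp add: sum_distrib_left[symmetric] sum_subtractf avg_def members_def)
  also have "\<dots> = (\<Sum>x\<in>G \<times> B. f x * (k * avg V x - k * \<theta> x))"
    by (subst sum.cartesian_product) (auto intro!: sum.cong)
  finally show ?thesis .
qed

section \<open>Averaging over the prior\<close>

lemma prob_space_prior: "prob_space prior"
  unfolding prior_def by (intro prob_space_PiM prob_space_uniform_prior)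

lemma AE_prior: "AE \<theta> in prior. \<forall>x\<in>G \<times> B. \<bar>\<theta> x\<bar> \<le> 1"
  unfolding prior_def
  by (intro AE_finite_allI AE_PiM_component prob_space_uniform_prior AE_uniform_prior) auto

lemma
  assumes "\<And>x. x \<in> G \<times> B \<Longrightarrow> continuous_on UNIV (h x)"
  shows integrable_prior_prod: "integrable prior (\<lambda>\<theta>. \<Prod>x\<in>G \<times> B. h x (\<theta> x) :: real)"
    and integral_prior_prod: "(\<integral>\<theta>. (\<Prod>x\<in>G \<times> B. h x (\<theta> x)) \<partial>prior) = (\<Prod>x\<in>G \<times> B. \<integral>t. h x t \<partial>uniform_prior)"
proof -
  interpret product_sigma_finite "\<lambda>_::'g \<times> 'b. uniform_prior"
    by unfold_locales (metis prob_space_uniform_prior prob_space_imp_sigma_finite sigma_finite_measure.sigma_finite_countable)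
  show "integrable prior (\<lambda>\<theta>. \<Prod>x\<in>G \<times> B. h x (\<theta> x))"
    unfolding prior_def using assms by (intro product_integrable_prod integrable_uniform_prior) auto
  show "(\<integral>\<theta>. (\<Prod>x\<in>G \<times> B. h x (\<theta> x)) \<partial>prior) = (\<Prod>x\<in>G \<times> B. \<integral>t. h x t \<partial>uniform_prior)"
    unfolding prior_def using assms by (intro product_integral_prod integrable_uniform_prior) auto
qed

text \<open>The extra factor is absorbed into coordinate \<open>x\<close>, which preserves the
  product form.\<close>

lemma weight_times_eq:
  assumes "x \<in> G \<times> B"
  shows "weight \<theta> V * h (\<theta> x) =
    (\<Prod>y\<in>G \<times> B. (\<Prod>i\<in>members (fst y). (1 + \<theta> y * V i (snd y)) / 2) * (if y = x then h (\<theta> y) else 1))"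
  using assms by (subst prod.distrib) (simp add: weight_eq)

lemma
  assumes "x \<in> G \<times> B" "continuous_on UNIV h"
  shows integrable_weight_times: "integrable prior (\<lambda>\<theta>. weight \<theta> V * h (\<theta> x))"
    and integral_weight_times: "(\<integral>\<theta>. weight \<theta> V * h (\<theta> x) \<partial>prior) =
      (\<Prod>y\<in>G \<times> B. \<integral>t. (\<Prod>i\<in>members (fst y). (1 + t * V i (snd y)) / 2) * (if y = x then h t else 1) \<partial>uniform_prior)"
proof -
  have c: "continuous_on UNIV (\<lambda>t. (\<Prod>i\<in>members (fst y). (1 + t * V i (snd y)) / 2) * (if y = x then h t else 1))" for y
    using assms(2) by (cases "y = x") (auto intro!: continuous_intros)
  show "integrable prior (\<lambda>\<theta>. weight \<theta> V * h (\<theta> x))"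
    unfolding weight_times_eq[OF assms(1)] by (intro integrable_prior_prod c)
  show "(\<integral>\<theta>. weight \<theta> V * h (\<theta> x) \<partial>prior) =
      (\<Prod>y\<in>G \<times> B. \<integral>t. (\<Prod>i\<in>members (fst y). (1 + t * V i (snd y)) / 2) * (if y = x then h t else 1) \<partial>uniform_prior)"
    unfolding weight_times_eq[OF assms(1)] by (intro integral_prior_prod c)
qed

lemma integrable_weight: "integrable prior (\<lambda>\<theta>. weight \<theta> V)"
  unfolding weight_eq by (intro integrable_prior_prod) (auto intro!: continuous_intros)

text \<open>After factoring, coordinate \<open>x\<close> contributes the one-dimensional integral
  that vanishes, with \<open>k * avg V x\<close> as the sum of its signs.\<close>

lemma integral_weight_score_zero:
  assumes "x \<in> G \<times> B" "V \<in> datasets"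
  shows "(\<integral>\<theta>. weight \<theta> V * (k * avg V x - (k + 2) * \<theta> x) \<partial>prior) = 0"
proof -
  have sg: "V i (snd x) = -1 \<or> V i (snd x) = 1" if "i \<in> members (fst x)" for i
  proof (rule signs_apply[of "V i" B "snd x"])
    show "V i \<in> signs B" using that assms by (intro datasets_apply) (auto simp: members_def)
    show "snd x \<in> B" using assms by auto
  qed
  have cd: "card (members (fst x)) = k" using assms card_members by (auto simp: members_def)
  have "(\<integral>t. (\<Prod>i\<in>members (fst x). (1 + t * V i (snd x)) / 2) * (k * avg V x - (k + 2) * t) \<partial>uniform_prior) = 0"
    using integral_uniform_prior_sign_weight[of "members (fst x)" "\<lambda>i. V i (snd x)", OF finite_members sg] k_pos
    by (simp add: cd avg_def add.commute)
  then have "(\<integral>t. (\<Prod>i\<in>members (fst x). (1 + t * V i (snd x)) / 2) *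
      (if x = x then k * avg V x - (k + 2) * t else 1) \<partial>uniform_prior) = 0"
    by simp
  then have "(\<Prod>y\<in>G \<times> B. \<integral>t. (\<Prod>i\<in>members (fst y). (1 + t * V i (snd y)) / 2) *
      (if y = x then k * avg V x - (k + 2) * t else 1) \<partial>uniform_prior) = 0"
    using assms(1) by (intro prod_zero bexI[of _ x]) auto
  then show ?thesis
    by (subst integral_weight_times[where h = "\<lambda>t. k * avg V x - (k + 2) * t", OF assms(1)])
      (auto intro!: continuous_intros)
qed

lemma weight_score_eq:
  fixes \<theta> :: "'g \<times> 'b \<Rightarrow> real"
  shows "weight \<theta> V * score \<theta> V f = (\<Sum>x\<in>G \<times> B. f x * (weight \<theta> V * (k * avg V x - k * \<theta> x)))"
  by (simp only: score_eq sum_distrib_left mult.left_commute)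

lemma integrable_weight_deviation:
  "x \<in> G \<times> B \<Longrightarrow> integrable prior (\<lambda>\<theta>. weight \<theta> V * (k * avg V x - k * \<theta> x))"
  by (rule integrable_weight_times[where h = "\<lambda>t. k * avg V x - k * t"]) (auto intro!: continuous_intros)

text \<open>Under the uniform prior the posterior mean of \<open>\<theta> x\<close> is the group
  average shrunk by \<open>k / (k + 2)\<close>. The centred sum
  \<open>k * avg V x - k * \<theta> x\<close> thus keeps the fraction \<open>2 / (k + 2)\<close> of
  \<open>k * avg V x\<close>.\<close>

lemma integral_weight_score:
  assumes "V \<in> datasets"
  shows "(\<integral>\<theta>. weight \<theta> V * score \<theta> V f \<partial>prior) = 2 * k / (k + 2) * (mix V * (\<Sum>x\<in>G \<times> B. f x * avg V x))"
proof -
  have one: "(\<integral>\<theta>. weight \<theta> V * (k * avg V x - k * \<theta> x) \<partial>prior) = 2 * k / (k + 2) * (mix V * avg V x)"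
    if x: "x \<in> G \<times> B" for x
  proof -
    have i1: "integrable prior (\<lambda>\<theta>. weight \<theta> V * \<theta> x)"
      using integrable_weight_times[OF x, of "\<lambda>t. t"] by simp
    have "(\<integral>\<theta>. weight \<theta> V * (k * avg V x - (k + 2) * \<theta> x) \<partial>prior) =
        (\<integral>\<theta>. k * avg V x * weight \<theta> V - (k + 2) * (weight \<theta> V * \<theta> x) \<partial>prior)"
      by (intro Bochner_Integration.integral_cong refl) (simp add: algebra_simps)
    also have "\<dots> = k * avg V x * mix V - (k + 2) * (\<integral>\<theta>. weight \<theta> V * \<theta> x \<partial>prior)"
      using i1 integrable_weight by (simp add: mix_def)
    finally have e: "(\<integral>\<theta>. weight \<theta> V * \<theta> x \<partial>prior) = k * avg V x * mix V / (k + 2)"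
      using integral_weight_score_zero[OF x assms] by (simp add: field_simps)
    have "(\<integral>\<theta>. weight \<theta> V * (k * avg V x - k * \<theta> x) \<partial>prior) =
        (\<integral>\<theta>. k * avg V x * weight \<theta> V - k * (weight \<theta> V * \<theta> x) \<partial>prior)"
      by (intro Bochner_Integration.integral_cong refl) (simp add: algebra_simps)
    also have "\<dots> = k * avg V x * mix V - k * (k * avg V x * mix V / (k + 2))"
      using i1 integrable_weight by (simp add: mix_def e)
    also have "\<dots> = 2 * k / (k + 2) * (mix V * avg V x)"
      by (simp add: field_simps)
    finally show ?thesis .
  qed
  have "(\<integral>\<theta>. weight \<theta> V * score \<theta> V f \<partial>prior) =
      (\<integral>\<theta>. (\<Sum>x\<in>G \<times> B. f x * (weight \<theta> V * (k * avg V x - k * \<theta> x))) \<partial>prior)"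
    by (simp only: weight_score_eq)
  also have "\<dots> = (\<Sum>x\<in>G \<times> B. f x * (\<integral>\<theta>. weight \<theta> V * (k * avg V x - k * \<theta> x) \<partial>prior))"
    by (subst Bochner_Integration.integral_sum)
      (auto intro!: integrable_mult_right integrable_weight_deviation)
  also have "\<dots> = (\<Sum>x\<in>G \<times> B. f x * (2 * k / (k + 2) * (mix V * avg V x)))"
    by (intro sum.cong refl) (simp only: one)
  finally show ?thesis by (simp add: sum_distrib_left mult_ac)
qed

lemma integrable_weight_score: "integrable prior (\<lambda>\<theta>. weight \<theta> V * score \<theta> V f)"
  unfolding weight_score_eq
  by (intro Bochner_Integration.integrable_sum integrable_mult_right integrable_weight_deviation)

text \<open>The output \<open>f V\<close> depends on the data but not on the biases, so for each
  fixed \<open>V\<close> it passes through the integral over the prior. A bound uniform in the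
  biases then controls the correlation with the averages under \<open>mix\<close>.\<close>

lemma fingerprinting:
  assumes "\<And>\<theta>. (\<And>x. x \<in> G \<times> B \<Longrightarrow> \<bar>\<theta> x\<bar> \<le> 1) \<Longrightarrow> (\<Sum>V\<in>datasets. weight \<theta> V * score \<theta> V (f V)) \<le> U"
  shows "2 * k / (k + 2) * (\<Sum>V\<in>datasets. mix V * (\<Sum>x\<in>G \<times> B. f V x * avg V x)) \<le> U"
proof -
  interpret prior: prob_space prior by (rule prob_space_prior)
  have "2 * k / (k + 2) * (\<Sum>V\<in>datasets. mix V * (\<Sum>x\<in>G \<times> B. f V x * avg V x)) =
      (\<integral>\<theta>. (\<Sum>V\<in>datasets. weight \<theta> V * score \<theta> V (f V)) \<partial>prior)"
    by (simp add: integrable_weight_score Bochner_Integration.integral_sum integral_weight_score sum_distrib_left)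
  also have "\<dots> \<le> (\<integral>\<theta>. U \<partial>prior)"
    using AE_prior
    by (intro integral_mono_AE Bochner_Integration.integrable_sum integrable_weight_score) (auto elim!: eventually_mono intro: assms)
  finally show ?thesis by (simp add: prior.prob_space)
qed

lemma mix_nonneg: "V \<in> datasets \<Longrightarrow> mix V \<ge> 0"
  unfolding mix_def using AE_prior
  by (intro integral_nonneg_AE) (auto elim!: eventually_mono intro: weight_nonneg)

lemma sum_mix: "(\<Sum>V\<in>datasets. mix V) = 1"
proof -
  interpret prior: prob_space prior by (rule prob_space_prior)
  have "(\<Sum>V\<in>datasets. mix V) = (\<integral>\<theta>. (\<Sum>V\<in>datasets. weight \<theta> V) \<partial>prior)"
    unfolding mix_def by (simp add: Bochner_Integration.integral_sum integrable_weight)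
  then show ?thesis by (simp add: sum_weight prior.prob_space)
qed

text \<open>For fixed biases the second moment of the average dominates its squared mean, and the
  prior has second moment \<open>1 / 3\<close>.\<close>

lemma sum_mix_avg_square:
  assumes x: "x \<in> G \<times> B"
  shows "(\<Sum>V\<in>datasets. mix V * (avg V x)\<^sup>2) \<ge> 1 / 3"
proof -
  interpret prior: prob_space prior by (rule prob_space_prior)
  let ?h = "\<lambda>y t. if y = x then t\<^sup>2 else (1::real)"
  have c: "continuous_on UNIV (?h y)" for y by (cases "y = x") (auto intro!: continuous_intros)
  have sq: "(\<lambda>\<theta>. (\<theta> x)\<^sup>2) = (\<lambda>\<theta>. \<Prod>y\<in>G \<times> B. ?h y (\<theta> y))"
    using x by auto
  have U: "(\<integral>t. 1 \<partial>uniform_prior) = (1::real)"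
    using prob_space.prob_space[OF prob_space_uniform_prior] by simp
  have "1 / 3 = (\<Prod>y\<in>G \<times> B. if y = x then \<integral>t. t\<^sup>2 \<partial>uniform_prior else (1::real))"
    using x integral_uniform_prior_square by simp
  also have "\<dots> = (\<Prod>y\<in>G \<times> B. \<integral>t. ?h y t \<partial>uniform_prior)"
    using U by (intro prod.cong refl) auto
  also have "\<dots> = (\<integral>\<theta>. (\<theta> x)\<^sup>2 \<partial>prior)"
    unfolding sq by (rule integral_prior_prod[symmetric, OF c])
  also have "\<dots> \<le> (\<integral>\<theta>. (\<Sum>V\<in>datasets. weight \<theta> V * (avg V x)\<^sup>2) \<partial>prior)"
  proof (rule integral_mono_AE)
    show "integrable prior (\<lambda>\<theta>. (\<theta> x)\<^sup>2)"
      unfolding sq by (rule integrable_prior_prod[OF c])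
    show "integrable prior (\<lambda>\<theta>. \<Sum>V\<in>datasets. weight \<theta> V * (avg V x)\<^sup>2)"
      by (intro Bochner_Integration.integrable_sum integrable_mult_left integrable_weight)
    show "AE \<theta> in prior. (\<theta> x)\<^sup>2 \<le> (\<Sum>V\<in>datasets. weight \<theta> V * (avg V x)\<^sup>2)"
      using AE_prior
    proof eventually_elim
      case (elim \<theta>)
      \<comment> \<open>Jensen's inequality by hand: the tangent of the square at
        \<open>\<theta> x\<close> is written as an average and then bounded by the square
        itself.\<close>
      have "(\<theta> x)\<^sup>2 = 2 * \<theta> x * (\<Sum>V\<in>datasets. weight \<theta> V * avg V x) - (\<theta> x)\<^sup>2 * (\<Sum>V\<in>datasets. weight \<theta> V)"
        using x by (simp only: sum_weight_avg sum_weight) (simp add: power2_eq_square)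
      also have "\<dots> = (\<Sum>V\<in>datasets. weight \<theta> V * (2 * \<theta> x * avg V x - (\<theta> x)\<^sup>2))"
        by (simp add: sum_subtractf sum_distrib_left algebra_simps)
      also have "\<dots> \<le> (\<Sum>V\<in>datasets. weight \<theta> V * (avg V x)\<^sup>2)"
      proof (intro sum_mono mult_left_mono)
        fix V assume "V \<in> datasets"
        then show "weight \<theta> V \<ge> 0" using elim by (intro weight_nonneg) auto
        have "0 \<le> (avg V x - \<theta> x)\<^sup>2" by simp
        then show "2 * \<theta> x * avg V x - (\<theta> x)\<^sup>2 \<le> (avg V x)\<^sup>2"
          by (simp add: power2_diff algebra_simps)
      qed
      finally show ?case .
    qed
  qed
  also have "\<dots> = (\<Sum>V\<in>datasets. mix V * (avg V x)\<^sup>2)"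
    by (simp add: Bochner_Integration.integral_sum integrable_weight mix_def)
  finally show ?thesis .
qed

section \<open>Privacy bounds the correlation\<close>

text \<open>For each participant, privacy lets the output come from a dataset in which that row is
  redrawn, at the cost of a factor \<open>c\<close> and of \<open>2 * card B * \<delta>\<close>. The
  row is then independent of the output, so its correlation has mean absolute value at most
  \<open>sqrt (card B)\<close>.\<close>

lemma score_private_le:
  fixes c \<delta> :: real
  assumes K: "\<And>V. V \<in> datasets \<Longrightarrow> prob_space (K V)" "\<And>V. V \<in> datasets \<Longrightarrow> sets (K V) = sets \<O>"
    and dp: "\<And>V i v E. V \<in> datasets \<Longrightarrow> i \<in> I \<Longrightarrow> v \<in> signs B \<Longrightarrow> E \<in> sets \<O> \<Longrightarrow>
      measure (K V) E \<le> c * measure (K (V(i := v))) E + \<delta>"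
    and c: "c \<ge> 0"
    and F: "\<And>x. (\<lambda>s. F s x) \<in> borel_measurable \<O>" "\<And>s x. \<bar>F s x\<bar> \<le> 1"
    and \<theta>: "\<And>x. x \<in> G \<times> B \<Longrightarrow> \<bar>\<theta> x\<bar> \<le> 1"
  shows "(\<Sum>V\<in>datasets. weight \<theta> V * score \<theta> V (\<lambda>x. \<integral>s. F s x \<partial>K V)) \<le>
    card I * (c * sqrt (card B) + 2 * card B * \<delta>)"
proof -
  \<comment> \<open>Contribution of a row \<open>v\<close> tested in position \<open>i\<close>
    against a single output \<open>s\<close>.\<close>
  define Z where "Z = (\<lambda>i s v. \<Sum>b\<in>B. F s (grp i, b) * (v b - \<theta> (grp i, b)))"
  have th: "\<bar>\<theta> (grp i, b)\<bar> \<le> 1" if "i \<in> I" "b \<in> B" for i b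
    using \<theta> grp that by simp
  have Zmeas: "(\<lambda>s. Z i s v) \<in> borel_measurable \<O>" for i v
    unfolding Z_def using F(1) by measurable
  have Fint: "integrable (K V) (\<lambda>s. F s x)" if "V \<in> datasets" for V x
  proof -
    interpret prob_space "K V" by (rule K(1)[OF that])
    show ?thesis
      using F K(2)[OF that] by (intro integrable_const_bound[where B = 1]) (auto cong: measurable_cong_sets)
  qed
  have Zint: "integrable (K V) (\<lambda>s. Z i s v)" if "V \<in> datasets" for V i v
    unfolding Z_def using Fint[OF that] by (intro Bochner_Integration.integrable_sum integrable_mult_left)
  have Zbound: "\<bar>Z i s v\<bar> \<le> 2 * card B" if "i \<in> I" "v \<in> signs B" for i s v
  proof -
    have "\<bar>Z i s v\<bar> \<le> (\<Sum>b\<in>B. \<bar>F s (grp i, b)\<bar> * \<bar>v b - \<theta> (grp i, b)\<bar>)"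
      unfolding Z_def abs_mult[symmetric] by (rule sum_abs)
    also have "\<dots> \<le> (\<Sum>b\<in>B. 1 * 2)"
    proof (intro sum_mono mult_mono F(2))
      fix b assume "b \<in> B"
      then show "\<bar>v b - \<theta> (grp i, b)\<bar> \<le> 2"
        using th[OF that(1), of b] signs_apply[OF that(2), of b] by auto
    qed auto
    finally show ?thesis by simp
  qed
  have score: "score \<theta> V (\<lambda>x. \<integral>s. F s x \<partial>K V) = (\<Sum>i\<in>I. \<integral>s. Z i s (V i) \<partial>K V)" if "V \<in> datasets" for V
    unfolding score_def Z_def using Fint[OF that] by (simp add: Bochner_Integration.integral_sum)
  have row: "(\<Sum>V\<in>datasets. weight \<theta> V * (\<integral>s. Z i s (V i) \<partial>K V)) \<le> c * sqrt (card B) + 2 * card B * \<delta>" if i: "i \<in> I" for i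
  proof -
    let ?\<Psi> = "\<lambda>V v. c * (\<integral>s. \<bar>Z i s v\<bar> \<partial>K V) + 2 * card B * \<delta>"
    let ?w = "\<lambda>i. row_weight B (\<lambda>b. \<theta> (grp i, b))"
    have upd: "V(i := v) \<in> datasets" if "V \<in> datasets" "v \<in> signs B" for V v
      using that i by (auto simp: datasets_def PiE_iff extensional_def)
    have "(\<Sum>V\<in>datasets. weight \<theta> V * (\<integral>s. Z i s (V i) \<partial>K V)) \<le>
        (\<Sum>V\<in>datasets. weight \<theta> V * (\<Sum>v\<in>signs B. ?w i v * ?\<Psi> V v))"
      unfolding datasets_def weight_def
    proof (rule sum_PiE_resample[where \<Phi> = "\<lambda>V v. \<integral>s. Z i s v \<partial>K V"])
      show "(\<Sum>v\<in>signs B. ?w i v) = 1" by (simp add: sum_row_weight)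
      show "0 \<le> ?w j v" if "j \<in> I" "v \<in> signs B" for j v
        using that th by (intro row_weight_nonneg) auto
      fix V v assume "V \<in> I \<rightarrow>\<^sub>E signs B" and v: "v \<in> signs B"
      then have V: "V \<in> datasets" by (simp add: datasets_def)
      have Vi: "V i \<in> signs B" using V i by (rule datasets_apply)
      note V' = upd[OF V v]
      \<comment> \<open>Absolute values come first because the transfer to another dataset needs a
        nonnegative function, here bounded by \<open>2 * card B\<close>.\<close>
      have "(\<integral>s. Z i s (V i) \<partial>K V) \<le> (\<integral>s. \<bar>Z i s (V i)\<bar> \<partial>K V)"
        using Zint[OF V] by (intro integral_mono) auto
      also have "\<dots> \<le> c * (\<integral>s. \<bar>Z i s (V i)\<bar> \<partial>K (V(i := v))) + 2 * card B * \<delta>"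
        using Zmeas Zbound[OF i Vi] K V V' c dp[OF V i v] by (intro integral_approx_DP) auto
      finally show "(\<integral>s. Z i s (V i) \<partial>K V) \<le> ?\<Psi> (V(i := v)) (V i)" .
    qed (use i in auto)
    also have "\<dots> \<le> (\<Sum>V\<in>datasets. weight \<theta> V * (c * sqrt (card B) + 2 * card B * \<delta>))"
    proof (intro sum_mono mult_left_mono weight_nonneg \<theta>)
      fix V assume V: "V \<in> datasets"
      interpret prob_space "K V" by (rule K(1)[OF V])
      \<comment> \<open>Exchanging sum and integral fixes the output \<open>s\<close>; the
        randomness of \<open>v\<close> alone then gives the square root.\<close>
      have "(\<Sum>v\<in>signs B. ?w i v * (\<integral>s. \<bar>Z i s v\<bar> \<partial>K V)) = (\<integral>s. (\<Sum>v\<in>signs B. ?w i v * \<bar>Z i s v\<bar>) \<partial>K V)"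
        using Zint[OF V] by (simp add: Bochner_Integration.integral_sum)
      also have "\<dots> \<le> (\<integral>s. sqrt (card B) \<partial>K V)"
        unfolding Z_def using Zint[OF V] th[OF i] F(2)
        by (intro integral_mono sum_row_weight_abs) (auto simp: Z_def)
      finally have le: "(\<Sum>v\<in>signs B. ?w i v * (\<integral>s. \<bar>Z i s v\<bar> \<partial>K V)) \<le> sqrt (card B)"
        by (simp add: prob_space)
      have "(\<Sum>v\<in>signs B. ?w i v * ?\<Psi> V v) =
          c * (\<Sum>v\<in>signs B. ?w i v * (\<integral>s. \<bar>Z i s v\<bar> \<partial>K V)) + 2 * card B * \<delta> * (\<Sum>v\<in>signs B. ?w i v)"
        by (simp add: sum_distrib_left sum.distrib algebra_simps)
      also have "\<dots> \<le> c * sqrt (card B) + 2 * card B * \<delta>"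
        using le c by (simp add: sum_row_weight mult_left_mono)
      finally show "(\<Sum>v\<in>signs B. ?w i v * ?\<Psi> V v) \<le> c * sqrt (card B) + 2 * card B * \<delta>" .
    qed auto
    also have "\<dots> = c * sqrt (card B) + 2 * card B * \<delta>"
      by (simp add: sum_distrib_right[symmetric] sum_weight)
    finally show ?thesis .
  qed
  have "(\<Sum>V\<in>datasets. weight \<theta> V * score \<theta> V (\<lambda>x. \<integral>s. F s x \<partial>K V)) =
      (\<Sum>i\<in>I. \<Sum>V\<in>datasets. weight \<theta> V * (\<integral>s. Z i s (V i) \<partial>K V))"
    by (simp add: score sum_distrib_left sum.swap[of _ I])
  also have "\<dots> \<le> (\<Sum>i\<in>I. c * sqrt (card B) + 2 * card B * \<delta>)"
    by (intro sum_mono row)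
  finally show ?thesis by simp
qed

lemma abs_avg_le:
  assumes "V \<in> datasets" "x \<in> G \<times> B"
  shows "\<bar>avg V x\<bar> \<le> 1"
proof -
  have "\<bar>\<Sum>i\<in>members (fst x). V i (snd x)\<bar> \<le> (\<Sum>i\<in>members (fst x). 1)"
  proof (rule order_trans[OF sum_abs sum_mono])
    fix i assume "i \<in> members (fst x)"
    then have "V i \<in> signs B" using assms by (intro datasets_apply) (auto simp: members_def)
    then show "\<bar>V i (snd x)\<bar> \<le> 1" using signs_apply[of "V i" B "snd x"] assms by auto
  qed
  also have "\<dots> = k" using assms card_members by (auto simp: members_def)
  finally show ?thesis using k_pos by (simp add: avg_def field_simps)
qed

text \<open>Accuracy bounds the correlation from below, privacy from above. Per entry,
  \<open>1 / 2 * (1 / 3)\<close> from the second moments less \<open>1 / 16\<close> for failure and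
  \<open>1 / 48\<close> for the error leaves \<open>1 / 12\<close>; the fingerprinting factor
  \<open>2 * k / (k + 2)\<close> is at least \<open>2 / 3\<close>.\<close>

theorem private_group_means_lower_bound:
  fixes c \<delta> :: real
  assumes K: "\<And>V. V \<in> datasets \<Longrightarrow> prob_space (K V)" "\<And>V. V \<in> datasets \<Longrightarrow> sets (K V) = sets \<O>"
    and dp: "\<And>V i v E. V \<in> datasets \<Longrightarrow> i \<in> I \<Longrightarrow> v \<in> signs B \<Longrightarrow> E \<in> sets \<O> \<Longrightarrow>
      measure (K V) E \<le> c * measure (K (V(i := v))) E + \<delta>"
    and c: "c \<ge> 0"
    and F: "\<And>x. (\<lambda>s. F s x) \<in> borel_measurable \<O>" "\<And>s x. \<bar>F s x\<bar> \<le> 1"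
    and A: "\<And>V. V \<in> datasets \<Longrightarrow> A V \<in> sets \<O>" "\<And>V. V \<in> datasets \<Longrightarrow> measure (K V) (A V) \<ge> 3 / 4"
    and close: "\<And>V s. V \<in> datasets \<Longrightarrow> s \<in> A V \<Longrightarrow>
      (\<Sum>x\<in>G \<times> B. (F s x - avg V x)\<^sup>2) \<le> (card G * card B) / 48\<^sup>2"
  shows "(card G * card B) / 18 \<le> card I * (c * sqrt (card B) + 2 * card B * \<delta>)"
proof -
  define D where "D = real (card G * card B)"
  have J: "card (G \<times> B) = card G * card B" by (simp add: card_cartesian_product)
  let ?f = "\<lambda>V x. \<integral>s. F s x \<partial>K V"
  have sq: "(sqrt D / 48)\<^sup>2 = D / 48\<^sup>2" by (simp add: power_divide D_def)
  have corr: "1 / 2 * (\<Sum>x\<in>G \<times> B. (avg V x)\<^sup>2) - D / 12 \<le> (\<Sum>x\<in>G \<times> B. ?f V x * avg V x)" if V: "V \<in> datasets" for V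
  proof -
    have "1 / 2 * (\<Sum>x\<in>G \<times> B. (avg V x)\<^sup>2) - card (G \<times> B) / 16 - sqrt D / 48 * sqrt (card (G \<times> B)) \<le>
        (\<Sum>x\<in>G \<times> B. ?f V x * avg V x)"
    proof (rule accurate_correlation_ge[where A = "A V"])
      show "(\<Sum>x\<in>G \<times> B. (F s x - avg V x)\<^sup>2) \<le> (sqrt D / 48)\<^sup>2" if "s \<in> A V" for s
        using close[OF V that] sq by (simp only: D_def)
    qed (use K[OF V] F A[OF V] abs_avg_le[OF V] in \<open>auto simp: D_def\<close>)
    moreover have "sqrt D / 48 * sqrt (card (G \<times> B)) = D / 48"
      by (simp add: J D_def)
    ultimately show ?thesis by (simp add: J D_def mult.commute)
  qed
  have "D / 12 = (\<Sum>x\<in>G \<times> B. 1 / 2 * (1 / 3)) - D / 12"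
    by (simp add: J D_def)
  also have "\<dots> \<le> (\<Sum>x\<in>G \<times> B. 1 / 2 * (\<Sum>V\<in>datasets. mix V * (avg V x)\<^sup>2)) - D / 12"
    by (intro diff_right_mono sum_mono mult_left_mono sum_mix_avg_square) auto
  also have "\<dots> = (\<Sum>V\<in>datasets. mix V * (1 / 2 * (\<Sum>x\<in>G \<times> B. (avg V x)\<^sup>2) - D / 12))"
  proof -
    have "(\<Sum>V\<in>datasets. mix V * (1 / 2 * (\<Sum>x\<in>G \<times> B. (avg V x)\<^sup>2) - D / 12)) =
        (\<Sum>V\<in>datasets. \<Sum>x\<in>G \<times> B. 1 / 2 * (mix V * (avg V x)\<^sup>2)) - (\<Sum>V\<in>datasets. mix V) * (D / 12)"
      by (simp add: right_diff_distrib sum_subtractf sum_distrib_left sum_distrib_right mult_ac)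
    then show ?thesis
      by (simp only: sum_mix sum.swap[of _ datasets] sum_distrib_left mult_1)
  qed
  also have "\<dots> \<le> (\<Sum>V\<in>datasets. mix V * (\<Sum>x\<in>G \<times> B. ?f V x * avg V x))"
    by (intro sum_mono mult_left_mono corr mix_nonneg)
  finally have low: "D / 12 \<le> (\<Sum>V\<in>datasets. mix V * (\<Sum>x\<in>G \<times> B. ?f V x * avg V x))" .
  have "D / 18 = 2 / 3 * (D / 12)" by simp
  also have "\<dots> \<le> 2 * k / (k + 2) * (\<Sum>V\<in>datasets. mix V * (\<Sum>x\<in>G \<times> B. ?f V x * avg V x))"
    using k_pos low by (intro mult_mono) (auto simp: field_simps D_def)
  also have "\<dots> \<le> card I * (c * sqrt (card B) + 2 * card B * \<delta>)"
  proof (rule fingerprinting)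
    fix \<theta> :: "'g \<times> 'b \<Rightarrow> real"
    assume \<theta>: "\<And>x. x \<in> G \<times> B \<Longrightarrow> \<bar>\<theta> x\<bar> \<le> 1"
    show "(\<Sum>V\<in>datasets. weight \<theta> V * score \<theta> V (?f V)) \<le> card I * (c * sqrt (card B) + 2 * card B * \<delta>)"
      by (rule score_private_le[where \<O> = \<O>, OF _ _ _ c F \<theta>]) (use K dp in auto)
  qed
  finally show ?thesis by (simp add: D_def)
qed

end

section \<open>Reduction to covariance estimation\<close>

text \<open>
  The first \<open>p * k\<close> rows carry the signs of \<open>V\<close>, tagged with the basis vector of their group. The
  next \<open>p * k\<close> rows carry the negated tags, which makes the mean of the first \<open>p\<close> coordinates
  vanish, so that the cross block of the empirical covariance is linear in \<open>V\<close>.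
\<close>
definition embed :: "nat \<Rightarrow> nat \<Rightarrow> nat \<Rightarrow> nat \<Rightarrow> nat \<Rightarrow> (nat \<Rightarrow> nat \<Rightarrow> real) \<Rightarrow> nat \<Rightarrow> nat \<Rightarrow> real" where
  "embed n d p k q V = (\<lambda>i\<in>{..<n}. \<lambda>a\<in>{..<d}.
     (if a < p then (if i < 2 * (p * k) \<and> a = i mod (p * k) div k then if i < p * k then 1 else -1 else 0)
      else if a < p + q \<and> i < p * k then V i (a - p) / sqrt q else 0) / sqrt 2)"

lemma sum_lessThan_split:
  fixes f :: "nat \<Rightarrow> real"
  assumes "p + q \<le> d" "\<And>a. p + q \<le> a \<Longrightarrow> f a = 0"
  shows "(\<Sum>a<d. f a) = (\<Sum>a<p. f a) + (\<Sum>b<q. f (p + b))"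
proof -
  have "(\<Sum>a<d. f a) = (\<Sum>a<p + q. f a)"
    using assms by (intro sum.mono_neutral_right) auto
  also have "\<dots> = (\<Sum>a<p. f a) + (\<Sum>a\<in>{p..<p + q}. f a)"
    by (subst sum.union_disjoint[symmetric]) (auto intro!: sum.cong)
  also have "(\<Sum>a\<in>{p..<p + q}. f a) = (\<Sum>b<q. f (p + b))"
    by (rule sum.reindex_bij_witness[of _ "\<lambda>b. p + b" "\<lambda>a. a - p"]) auto
  finally show ?thesis .
qed


lemma grouped_signs_div:
  assumes "k > 0"
  shows "grouped_signs {..<p * k} {..<q::nat} {..<p} (\<lambda>i. i div k) k"
proof
  fix g assume "g \<in> {..<p}"
  then have "Suc g * k \<le> p * k" by (intro mult_le_mono1) simp
  then have "{i \<in> {..<p * k}. i div k = g} = {g * k..<g * k + k}"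
    using assms by (auto simp: div_nat_eqI less_mult_imp_div_less dividend_less_times_div mult.commute
        intro: less_le_trans) (metis dividend_less_times_div mult.commute add.commute)+
  then show "card {i \<in> {..<p * k}. i div k = g} = k" by simp
qed (use assms in \<open>auto simp: less_mult_imp_div_less\<close>)

text \<open>The scalings by \<open>sqrt 2\<close> and \<open>sqrt q\<close> give the tag block and
  the sign block squared norm at most \<open>1 / 2\<close> each.\<close>

lemma embed_in_unit_ball:
  assumes "V \<in> {..<p * k} \<rightarrow>\<^sub>E signs {..<q}" "p + q \<le> d"
  shows "embed n d p k q V \<in> {..<n} \<rightarrow>\<^sub>E unit_ball d"
proof (intro PiE_I)
  fix i assume i: "i \<in> {..<n}"
  let ?x = "embed n d p k q V i"
  have "(\<Sum>a<d. (?x a)\<^sup>2) = (\<Sum>a<p. (?x a)\<^sup>2) + (\<Sum>b<q. (?x (p + b))\<^sup>2)"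
    using assms(2) i
    by (subst sum.cong[OF refl, of "{..<d}" _ "\<lambda>a. if a < p + q then (?x a)\<^sup>2 else 0"])
      (auto simp: embed_def sum_lessThan_split)
  also have "(\<Sum>a<p. (?x a)\<^sup>2) \<le> (\<Sum>a<p. if a = i mod (p * k) div k then 1 / 2 else 0)"
    using assms(2) i by (intro sum_mono) (auto simp: embed_def power_divide)
  also have "\<dots> \<le> 1 / 2" by (simp add: sum.delta)
  also have "(\<Sum>b<q. (?x (p + b))\<^sup>2) \<le> (\<Sum>b<q. 1 / (2 * q))"
  proof (rule sum_mono)
    fix b assume b: "b \<in> {..<q}"
    have "(V i b)\<^sup>2 = 1" if "i < p * k"
      using signs_apply[of "V i" "{..<q}" b] assms(1) b that by (auto simp: PiE_iff)
    then show "(?x (p + b))\<^sup>2 \<le> 1 / (2 * q)"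
      using assms(2) i b by (auto simp: embed_def power_divide)
  qed
  also have "\<dots> \<le> 1 / 2" by simp
  finally have "(\<Sum>a<d. (?x a)\<^sup>2) \<le> 1" by simp
  then show "?x \<in> unit_ball d"
    using i by (auto simp: unit_ball_def L2_set_def embed_def)
qed (auto simp: embed_def)

text \<open>Redrawing one participant alters at most one row of the embedded dataset, so one
  application of privacy covers it.\<close>

lemma embed_update:
  assumes "i < p * k" "j \<noteq> i"
  shows "embed n d p k q (V(i := v)) j = embed n d p k q V j"
  using assms by (auto simp: embed_def)

lemma empirical_mean_embed:
  assumes "2 * (p * k) \<le> n" "g < p" "p \<le> d"
  shows "empirical_mean n d (embed n d p k q V) g = 0"
proof -
  let ?N = "p * k"
  define h where "h = (\<lambda>i. if g = i mod ?N div k then 1 / sqrt 2 else 0)"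
  have "(\<Sum>i<n. embed n d p k q V i g) = (\<Sum>i<n. if i < ?N then h i else if i < ?N + ?N then - h i else 0)"
    using assms by (intro sum.cong refl) (auto simp: embed_def h_def)
  \<comment> \<open>The rows are split with both block lengths equal to \<open>?N\<close>;
    \<open>h\<close> has period \<open>?N\<close>, so the two halves cancel.\<close>
  also have "\<dots> = (\<Sum>i<?N. if i < ?N then h i else if i < ?N + ?N then - h i else 0) +
      (\<Sum>j<?N. if ?N + j < ?N then h (?N + j) else if ?N + j < ?N + ?N then - h (?N + j) else 0)"
    using assms(1) by (intro sum_lessThan_split) auto
  also have "\<dots> = (\<Sum>i<?N. h i) + (\<Sum>i<?N. - h i)"
    by (intro arg_cong2[where f = "(+)"] sum.cong refl) (auto simp: h_def)
  also have "\<dots> = 0" by (simp add: sum_negf)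
  finally show ?thesis using assms by (simp add: empirical_mean_def)
qed

text \<open>Tags and signs overlap only in the first \<open>p * k\<close> rows, and the product of
  means vanishes with the mean of the tag.\<close>

lemma empirical_cov_embed:
  assumes "2 * (p * k) \<le> n" "p + q \<le> d" "g < p" "b < q" "n > 0"
  shows "empirical_cov n d (embed n d p k q V) (g, p + b) =
    (\<Sum>i\<in>{i\<in>{..<p * k}. i div k = g}. V i b) / (2 * n * sqrt q)"
proof -
  let ?X = "embed n d p k q V"
  have "(\<Sum>i<n. ?X i g * ?X i (p + b)) = (\<Sum>i\<in>{i\<in>{..<p * k}. i div k = g}. ?X i g * ?X i (p + b))"
    using assms by (intro sum.mono_neutral_right) (auto simp: embed_def)
  also have "\<dots> = (\<Sum>i\<in>{i\<in>{..<p * k}. i div k = g}. V i b / (2 * sqrt q))"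
    using assms by (intro sum.cong refl) (auto simp: embed_def)
  also have "\<dots> = (\<Sum>i\<in>{i\<in>{..<p * k}. i div k = g}. V i b) / (2 * sqrt q)"
    by (simp add: sum_divide_distrib)
  finally have "empirical_cov n d ?X (g, p + b) =
      (1 / real n) * ((\<Sum>i\<in>{i\<in>{..<p * k}. i div k = g}. V i b) / (2 * sqrt q)) - 0 * empirical_mean n d ?X (p + b)"
    using assms by (subst empirical_cov_alt) (auto simp: empirical_mean_embed)
  then show ?thesis by simp
qed

text \<open>A covariance estimator yields an estimator of the group averages: after rescaling by
  \<open>2 * n * sqrt q / k\<close>, the hypothesis on \<open>\<alpha>\<close> becomes a squared
  error of at most \<open>p * q / 48\<^sup>2\<close> on the cross block. The conclusion is to be
  contradicted by a choice of sizes.\<close>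

lemma private_covariance_lower_bound:
  fixes p k q n d :: nat and \<epsilon> \<delta> \<alpha> :: real
  assumes pos: "k > 0" "q > 0" "n > 0" and sizes: "2 * (p * k) \<le> n" "p + q \<le> d"
    and dp: "differentially_private \<epsilon> \<delta> n (unit_ball d) (matrix_space d) M" and \<epsilon>: "\<epsilon> \<ge> 0" and \<delta>: "\<delta> \<ge> 0"
    and acc: "\<forall>X \<in> {..<n} \<rightarrow>\<^sub>E unit_ball d.
      \<P>(S in M X. frobenius_dist d S (empirical_cov n d X) \<le> \<alpha>) \<ge> 3 / 4"
    and \<alpha>: "\<alpha> \<le> k * sqrt p / (96 * n)"
  shows "p * q / 18 \<le> p * k * (exp \<epsilon> * sqrt q + 2 * q * \<delta>)"
proof -
  interpret grouped_signs "{..<p * k}" "{..<q}" "{..<p}" "\<lambda>i. i div k" k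
    by (rule grouped_signs_div[OF pos(1)])
  let ?X = "embed n d p k q"
  define L where "L = 2 * n * sqrt q / k"
  \<comment> \<open>Clipping makes the estimate bounded without increasing the error, as the true
    averages lie in \<open>[-1, 1]\<close>.\<close>
  define F where "F = (\<lambda>s x. if x \<in> {..<p} \<times> {..<q} then max (-1) (min 1 (L * s (fst x, p + snd x))) else (0::real))"
  define A where "A = (\<lambda>V. {S \<in> space (matrix_space d). frobenius_dist d S (empirical_cov n d (?X V)) \<le> \<alpha>})"
  have L: "L > 0" using pos by (simp add: L_def)
  have X: "?X V \<in> {..<n} \<rightarrow>\<^sub>E unit_ball d" if "V \<in> datasets" for V
    using that sizes(2) by (intro embed_in_unit_ball) (auto simp: datasets_def)
  have K: "prob_space (M (?X V))" "sets (M (?X V)) = sets (matrix_space d)" if "V \<in> datasets" for V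
    using dp X[OF that] by (auto simp: differentially_private_def randomized_algorithm_def space_prob_algebra)
  have dp': "measure (M (?X V)) E \<le> exp \<epsilon> * measure (M (?X (V(i := v)))) E + \<delta>"
    if "V \<in> datasets" "i \<in> {..<p * k}" "v \<in> signs {..<q}" "E \<in> sets (matrix_space d)" for V i v E
  \<comment> \<open>If the redrawn row embeds to the old one, the datasets are equal rather than
    neighbouring, and \<open>1 \<le> exp \<epsilon>\<close> with \<open>0 \<le> \<delta>\<close>
    suffices.\<close>
  proof (cases "?X (V(i := v)) i = ?X V i")
    case True
    then have "?X (V(i := v)) = ?X V"
      using that(2) by (intro ext) (metis embed_update lessThan_iff)
    moreover have "measure (M (?X V)) E \<le> exp \<epsilon> * measure (M (?X V)) E"
      using \<epsilon> mult_right_mono[of 1 "exp \<epsilon>" "measure (M (?X V)) E"] by simp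
    ultimately show ?thesis using \<delta> by simp
  next
    case False
    have "V(i := v) \<in> datasets"
      using that by (auto simp: datasets_def PiE_iff extensional_def)
    moreover have "{j \<in> {..<n}. ?X (V(i := v)) j \<noteq> ?X V j} = {i}"
      using False that(2) sizes(1) by (auto simp: embed_update)
    then have "neighbouring n (?X (V(i := v))) (?X V)"
      by (simp add: neighbouring_def)
    ultimately show ?thesis
      using dp X that(1,4) unfolding differentially_private_def by blast
  qed
  have Fmeas: "(\<lambda>s. F s x) \<in> borel_measurable (matrix_space d)" for x
  proof (cases "x \<in> {..<p} \<times> {..<q}")
    case True
    then have [measurable]: "(\<lambda>s. s (fst x, p + snd x)) \<in> borel_measurable (matrix_space d)"
      unfolding matrix_space_def using sizes(2) by (intro measurable_component_singleton) auto
    show ?thesis using True by (simp add: F_def)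
  qed (auto simp: F_def)
  have F1: "\<bar>F s x\<bar> \<le> 1" for s x by (auto simp: F_def)
  have Ameas: "A V \<in> sets (matrix_space d)" for V
    unfolding A_def by (rule frobenius_ball_measurable)
  have Aprob: "measure (M (?X V)) (A V) \<ge> 3 / 4" if "V \<in> datasets" for V
    using bspec[OF acc X[OF that]] sets_eq_imp_space_eq[OF K(2)[OF that]] by (simp add: A_def)
  have close: "(\<Sum>x\<in>{..<p} \<times> {..<q}. (F s x - avg V x)\<^sup>2) \<le> (card {..<p} * card {..<q}) / 48\<^sup>2"
    if V: "V \<in> datasets" and s: "s \<in> A V" for V s
  proof -
    let ?C = "empirical_cov n d (?X V)"
    let ?m = "\<lambda>x. (fst x, p + snd x)"
    have "(F s x - avg V x)\<^sup>2 \<le> L\<^sup>2 * (s (?m x) - ?C (?m x))\<^sup>2" if x: "x \<in> {..<p} \<times> {..<q}" for x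
    proof -
      have "?C (?m x) = (\<Sum>i\<in>members (fst x). V i (snd x)) / (2 * n * sqrt q)"
        using x sizes pos unfolding members_def by (subst empirical_cov_embed) auto
      then have C: "L * ?C (?m x) = avg V x"
        using pos by (simp add: L_def avg_def)
      have "\<bar>F s x - avg V x\<bar> \<le> \<bar>L * s (?m x) - avg V x\<bar>"
        using abs_avg_le[OF V x] x by (auto simp: F_def)
      then have "(F s x - avg V x)\<^sup>2 \<le> (L * s (?m x) - avg V x)\<^sup>2"
        by (rule abs_le_square_iff[THEN iffD1])
      then show ?thesis
        by (simp add: C[symmetric] right_diff_distrib[symmetric] power_mult_distrib)
    qed
    then have "(\<Sum>x\<in>{..<p} \<times> {..<q}. (F s x - avg V x)\<^sup>2) \<le>
        L\<^sup>2 * (\<Sum>x\<in>{..<p} \<times> {..<q}. (s (?m x) - ?C (?m x))\<^sup>2)"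
      unfolding sum_distrib_left by (rule sum_mono)
    also have "(\<Sum>x\<in>{..<p} \<times> {..<q}. (s (?m x) - ?C (?m x))\<^sup>2) = (\<Sum>y\<in>?m ` ({..<p} \<times> {..<q}). (s y - ?C y)\<^sup>2)"
      by (subst sum.reindex) (auto simp: inj_on_def)
    also have "\<dots> \<le> (\<Sum>y\<in>{..<d} \<times> {..<d}. (s y - ?C y)\<^sup>2)"
      using sizes(2) by (intro sum_mono2) auto
    also have "\<dots> = (frobenius_dist d s ?C)\<^sup>2"
      by (simp add: frobenius_dist_def L2_set_def sum_nonneg)
    also have "\<dots> \<le> (k * sqrt p / (96 * n))\<^sup>2"
      using s \<alpha> by (intro power_mono) (auto simp: A_def frobenius_dist_def)
    also have "L\<^sup>2 * (k * sqrt p / (96 * n))\<^sup>2 = (card {..<p} * card {..<q}) / 48\<^sup>2"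
      using pos by (simp add: L_def power_divide power_mult_distrib)
    finally show ?thesis by (simp add: mult_left_mono)
  qed
  have "real (card {..<p} * card {..<q}) / 18 \<le> card {..<p * k} * (exp \<epsilon> * sqrt (card {..<q}) + 2 * card {..<q} * \<delta>)"
    by (rule private_group_means_lower_bound[where K = "\<lambda>V. M (?X V)" and \<O> = "matrix_space d" and F = F and A = A])
      (use K dp' Fmeas F1 Ameas Aprob close in auto)
  then show ?thesis by simp
qed

section \<open>Choice of block sizes\<close>

text \<open>The intended \<open>t\<close> is the smaller of \<open>d\<close> and
  \<open>n powr (2 / 3)\<close>. Taking \<open>p\<close> near \<open>t / 4\<close> and
  \<open>k\<close> near \<open>sqrt t / 200\<close> keeps \<open>p * k\<close> within reach of
  \<open>t powr (3 / 2) \<le> n\<close>, keeps \<open>k\<close> below a small multiple of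
  \<open>sqrt q\<close>, and makes \<open>k * sqrt p\<close> at least
  \<open>t / 400\<close>.\<close>

lemma block_sizes:
  fixes n d :: nat and t :: real
  assumes n: "n \<ge> 2" and d: "d \<ge> 40000" and t: "1 \<le> t" "t \<le> d" "t \<le> n powr (2 / 3)"
  obtains p k q :: nat where "p > 0" "k > 0" "q > 0" "2 * (p * k) \<le> n" "p + q \<le> d"
    "k * (exp 1 * sqrt q + 2 * q * (1 / (real d)\<^sup>2)) < q / 18" "t / (38400 * n) \<le> k * sqrt p / (96 * n)"
proof
  let ?p = "nat \<lceil>t / 4\<rceil>" and ?k = "nat \<lceil>sqrt t / 200\<rceil>" and ?q = "d div 2"
  have st: "sqrt t \<ge> 1" "sqrt t \<le> sqrt d" using t by auto
  have p: "t / 4 \<le> ?p" "?p < t / 4 + 1" using t by linarith+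
  have k: "sqrt t / 200 \<le> ?k" "?k < sqrt t / 200 + 1" using st by linarith+
  show pos: "?p > 0" "?k > 0" using p(1) k(1) t(1) st(1) by linarith+
  show "?q > 0" using d by simp
  have "?p + real ?q \<le> d"
    using p(2) t(2) d by linarith
  then show "?p + ?q \<le> d" by linarith
  show "2 * (?p * ?k) \<le> n"
  proof -
    have tn: "t \<le> n" 
      using t(3) n powr_mono[of "2 / 3" 1 "real n"] by simp
    \<comment> \<open>Rounding up matters for small \<open>t\<close>: up to \<open>40000\<close> the
      ceiling gives \<open>k = 1\<close>, up to \<open>4\<close> also \<open>p = 1\<close>. Beyond
      \<open>40000\<close> each rounded value is at most twice the unrounded one.\<close>
    consider "t \<le> 4" | "4 < t" "t \<le> 40000" | "t > 40000" by linarith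
    then show ?thesis
    proof cases
      case 1
      then have "sqrt t \<le> 2" by (simp add: real_le_lsqrt)
      then have "?k = 1" "?p = 1" using k(2) p(2) pos 1 by linarith+
      then show ?thesis using n by simp
    next
      case 2
      then have "sqrt t \<le> 200" by (simp add: real_le_lsqrt)
      then have "?k = 1" using k(2) pos by linarith
      moreover have "2 * real ?p \<le> n" using p(2) 2 tn by linarith
      ultimately show ?thesis by simp
    next
      case 3
      then have "200 < sqrt t" by (simp add: real_less_rsqrt)
      then have k': "?k \<le> sqrt t / 100" using k(2) by linarith
      have p': "?p \<le> t / 2" using p(2) 3 by linarith
      have "sqrt t \<le> n powr (1 / 3)"
      proof (rule real_le_lsqrt)
        show "t \<le> (n powr (1 / 3))\<^sup>2"
          using t(3) n by (simp add: power2_eq_square powr_add[symmetric])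
      qed (use t in auto)
      then have "t * sqrt t \<le> n powr (2 / 3) * n powr (1 / 3)"
        using t st by (intro mult_mono) auto
      then have ts: "t * sqrt t \<le> n" using n by (simp add: powr_add[symmetric])
      have "2 * (real ?p * real ?k) \<le> 2 * (t / 2 * (sqrt t / 100))"
        by (intro mult_left_mono mult_mono p' k' of_nat_0_le_iff) (use t(1) in simp_all)
      also have "\<dots> \<le> n" using ts by simp
      finally show ?thesis by (metis (mono_tags) of_nat_le_iff of_nat_mult of_nat_numeral)
    qed
  qed
  \<comment> \<open>\<open>d \<ge> 40000\<close> gives \<open>1 \<le> sqrt d / 200\<close>, which
    absorbs the rounding of \<open>k\<close>.\<close>
  have sd: "sqrt d \<ge> 200" using d by (simp add: real_le_rsqrt)
  have kd: "?k \<le> sqrt d / 100" using k(2) st(2) sd by linarith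
  have q: "real ?q \<ge> 49 / 100 * d" using d by linarith
  have q1: "sqrt ?q \<ge> 1" using d by simp
  have sq: "sqrt ?q \<ge> 7 / 10 * sqrt d"
  proof (rule real_le_rsqrt)
    show "(7 / 10 * sqrt d)\<^sup>2 \<le> ?q" using q by (simp add: power_mult_distrib power_divide)
  qed
  have "2 * ?q * (1 / (real d)\<^sup>2) \<le> d * (1 / (real d)\<^sup>2)"
    by (intro mult_right_mono) auto
  also have "\<dots> = 1 / d" using d by (simp add: power2_eq_square)
  also have "\<dots> \<le> 1 / 10 * 1" using d by (simp add: field_simps)
  also have "\<dots> \<le> 1 / 10 * sqrt ?q" using q1 by (rule mult_left_mono) simp
  \<comment> \<open>As \<open>exp 1 \<le> 3\<close>, the bracket is at most
    \<open>31 / 10 * sqrt ?q\<close>. Then \<open>sqrt d \<le> 10 / 7 * sqrt ?q\<close> produces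
    \<open>310 / 7000\<close>, which is below \<open>1 / 18\<close>.\<close>
  finally have "exp 1 * sqrt ?q + 2 * ?q * (1 / (real d)\<^sup>2) \<le> 3 * sqrt ?q + 1 / 10 * sqrt ?q"
    using exp_le by (intro add_mono mult_right_mono) auto
  then have "?k * (exp 1 * sqrt ?q + 2 * ?q * (1 / (real d)\<^sup>2)) \<le> sqrt d / 100 * (31 / 10 * sqrt ?q)"
    using kd by (intro mult_mono) auto
  also have "\<dots> \<le> (sqrt ?q * (10 / 7)) / 100 * (31 / 10 * sqrt ?q)"
    using sq by (intro mult_right_mono divide_right_mono) auto
  also have "\<dots> = 310 / 7000 * ?q" by simp
  also have "\<dots> < ?q / 18" using d by simp
  finally show "?k * (exp 1 * sqrt ?q + 2 * ?q * (1 / (real d)\<^sup>2)) < ?q / 18" .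
  have "sqrt t / 2 \<le> sqrt ?p"
    using p(1) t(1) by (intro real_le_rsqrt) (simp add: power_divide)
  then have "sqrt t / 200 * (sqrt t / 2) \<le> ?k * sqrt ?p"
    using t(1) by (intro mult_mono k(1) of_nat_0_le_iff) simp_all
  then have "t / 400 \<le> ?k * sqrt ?p" using t(1) by simp
  then have "t / 400 / (96 * n) \<le> ?k * sqrt ?p / (96 * n)" by (rule divide_right_mono) simp
  then show "t / (38400 * n) \<le> ?k * sqrt ?p / (96 * n)" by simp
qed

theorem corollary6p3:
  "\<exists>c C A B :: real. c > 0 \<and> C > 0 \<and> A > 0 \<and> B > 0 \<and>
     (\<forall>(n::nat) (d::nat) (\<alpha>::real)
        (M :: (nat \<Rightarrow> nat \<Rightarrow> real) \<Rightarrow> (nat \<times> nat \<Rightarrow> real) measure).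
        n \<ge> 2 \<longrightarrow> d \<ge> 1 \<longrightarrow>
        real d \<ge> B * sqrt (real n) * ln (real n) powr A \<longrightarrow>
        differentially_private 1 (1 / (real d)\<^sup>2) n (unit_ball d) (matrix_space d) M \<longrightarrow>
        (\<forall>X \<in> {..<n} \<rightarrow>\<^sub>E unit_ball d.
           \<P>(S in M X. frobenius_dist d S (empirical_cov n d X) \<le> \<alpha>) \<ge> 3 / 4) \<longrightarrow>
        (real d \<le> real n powr (2 / 3) \<longrightarrow>
           \<alpha> \<ge> c / ln (real n) powr C * (real d / real n)) \<and>
        (real d \<ge> real n powr (2 / 3) \<longrightarrow>
           \<alpha> \<ge> c / ln (real n) powr C * (1 / real n powr (1 / 3))))"
proof -
  have bound: "t / (38400 * n) \<le> \<alpha>"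
    if n: "n \<ge> 2" and d: "d \<ge> 40000" and t: "1 \<le> t" "t \<le> d" "t \<le> n powr (2 / 3)"
      and dp: "differentially_private 1 (1 / (real d)\<^sup>2) n (unit_ball d) (matrix_space d) M"
      and acc: "\<forall>X \<in> {..<n} \<rightarrow>\<^sub>E unit_ball d.
         \<P>(S in M X. frobenius_dist d S (empirical_cov n d X) \<le> \<alpha>) \<ge> 3 / 4"
    for n d :: nat and t \<alpha> :: real and M
  proof (rule ccontr)
    assume "\<not> t / (38400 * n) \<le> \<alpha>"
    moreover obtain p k q :: nat where pkq: "p > 0" "k > 0" "q > 0" "2 * (p * k) \<le> n" "p + q \<le> d"
      "k * (exp 1 * sqrt q + 2 * q * (1 / (real d)\<^sup>2)) < q / 18" "t / (38400 * n) \<le> k * sqrt p / (96 * n)"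
      using block_sizes[OF n d t] .
    ultimately have "\<alpha> \<le> k * sqrt p / (96 * n)" by linarith
    then have "p * q / 18 \<le> p * k * (exp 1 * sqrt q + 2 * q * (1 / (real d)\<^sup>2))"
      using n by (intro private_covariance_lower_bound[OF pkq(2,3) _ pkq(4,5) dp _ _ acc]) auto
    \<comment> \<open>Cancelling \<open>p > 0\<close> contradicts the strict inequality that the
      sizes were chosen to satisfy.\<close>
    then have "real p * (q / 18) \<le> p * (k * (exp 1 * sqrt q + 2 * q * (1 / (real d)\<^sup>2)))"
      by (simp add: mult.assoc)
    then show False
      using pkq(1,6) by (simp only: mult_le_cancel_left_pos of_nat_0_less_iff)
  qed
  have main: "1 / 76800 / ln n powr 1 * (t / n) \<le> \<alpha>"
    if n: "n \<ge> 2" and large: "80000 * sqrt n * ln n powr 1 \<le> d" and t: "1 \<le> t" "t \<le> d" "t \<le> n powr (2 / 3)"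
      and dp: "differentially_private 1 (1 / (real d)\<^sup>2) n (unit_ball d) (matrix_space d) M"
      and acc: "\<forall>X \<in> {..<n} \<rightarrow>\<^sub>E unit_ball d.
         \<P>(S in M X. frobenius_dist d S (empirical_cov n d X) \<le> \<alpha>) \<ge> 3 / 4"
    for n d :: nat and t \<alpha> :: real and M
  proof -
    have "ln 2 \<le> ln (real n)" using n by simp
    then have ln: "1 / 2 \<le> ln (real n)" using ln2_ge_two_thirds by linarith
    \<comment> \<open>The constant \<open>80000\<close> is twice the threshold on \<open>d\<close>,
      to make up for \<open>ln n \<ge> 1 / 2\<close>.\<close>
    have "1 * (1 / 2) \<le> sqrt n * ln n" using n ln by (intro mult_mono) auto
    then have "40000 \<le> real d" using large ln by simp
    then have d: "40000 \<le> d" by simp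
    \<comment> \<open>As \<open>1 / ln n \<le> 2\<close>, halving \<open>1 / 38400\<close> absorbs
      the logarithm.\<close>
    have "1 / 76800 / ln n powr 1 \<le> 1 / 38400" using ln by (simp add: field_simps)
    then have "1 / 76800 / ln n powr 1 * (t / n) \<le> 1 / 38400 * (t / n)"
      using t(1) by (intro mult_right_mono) auto
    also have "\<dots> \<le> \<alpha>" using bound[OF n d t dp acc] by simp
    finally show ?thesis .
  qed
  show ?thesis
  proof (rule exI[of _ "1 / 76800"], rule exI[of _ 1], rule exI[of _ 1], rule exI[of _ 80000], intro conjI allI impI)
    fix n d :: nat and \<alpha> :: real and M
    assume n: "2 \<le> n" and d: "1 \<le> d" and large: "80000 * sqrt n * ln n powr 1 \<le> d"
      and dp: "differentially_private 1 (1 / (real d)\<^sup>2) n (unit_ball d) (matrix_space d) M"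
      and acc: "\<forall>X \<in> {..<n} \<rightarrow>\<^sub>E unit_ball d.
         \<P>(S in M X. frobenius_dist d S (empirical_cov n d X) \<le> \<alpha>) \<ge> 3 / 4"
    \<comment> \<open>The first regime takes \<open>t = d\<close>, the second
      \<open>t = n powr (2 / 3)\<close>.\<close>
    show "1 / 76800 / ln n powr 1 * (d / n) \<le> \<alpha>" if "d \<le> n powr (2 / 3)"
      using main[OF n large _ _ that dp acc] d by simp
    have "n powr (2 / 3) / n = 1 / n powr (1 / 3)"
      using n powr_diff[of n "2 / 3" 1] powr_minus_divide[of n "1 / 3"] by simp
    then show "1 / 76800 / ln n powr 1 * (1 / n powr (1 / 3)) \<le> \<alpha>" if "n powr (2 / 3) \<le> d"
      using main[OF n large _ that _ dp acc] n ge_one_powr_ge_zero[of "real n" "2 / 3"] by simp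
  qed auto
qed

end
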